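(* Let $v_1,v_2\in\mathbb{R}^2$ be linearly independent and let $\mathbb{T}^2=\mathbb{R}^2/\langle v_1,v_2\rangle$ be the associated flat torus. Let $f$ be a $C^1$ function, $\alpha\le 0$ a constant, and let $\Omega$ be a (connected) domain of $\mathbb{T}^2$ that supports a solution $u\in C^2(\overline\Omega)\cap C^3(\Omega)$ to \[ \Delta u+f(u)=0 \ \text{ in }\Omega,\qquad u>0\ \text{ in }\Omega,\qquad u=0\ \text{ on }\partial\Omega,\qquad \langle\nabla u,\nu\rangle=\alpha\ \text{ on }\partial\Omega . \] Suppose that \[ 2\,\max_{x\in\overline\Omega}\int_0^{u(x)} f(s)\,ds<\alpha^2 . \] Then each component of $\mathbb{T}^2\setminus\Omega$ is strictly convex.
   Context: $\langle v_1,v_2\rangle=\{a v_1+b v_2: a,b\in\mathbb{Z}\}$ is the lattice generated by $v_1,v_2$. $\partial\Omega$ is of class $C^2$ and $\nu$ is the outward unit normal to $\partial\Omega$. A component of $\mathbb{T}^2\setminus\Omega$ is strictly convex if each connected component of its preimage in $\mathbb{R}^2$ is strictly convex. *)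

theory Defs
  imports "HOL-Analysis.Analysis"
begin

section \<open>The flat torus\<close>

definition lattice :: "real^2 \<Rightarrow> real^2 \<Rightarrow> (real^2) set" where
  "lattice v1 v2 = {of_int a *\<^sub>R v1 + of_int b *\<^sub>R v2 | a b :: int. True}"

text \<open>Points of the torus are the cosets of the lattice \<open>L\<close>.\<close>

definition torus_proj :: "(real^2) set \<Rightarrow> real^2 \<Rightarrow> (real^2) set" where
  "torus_proj L x = (\<lambda>l. x + l) ` L"

definition torus :: "(real^2) set \<Rightarrow> (real^2) set topology" where
  "torus L = topology (\<lambda>U. U \<subseteq> range (torus_proj L) \<and> open (torus_proj L -` U))"

lemma openin_torus:
  "openin (torus L) U \<longleftrightarrow> U \<subseteq> range (torus_proj L) \<and> open (torus_proj L -` U)"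
proof -
  have "istopology (\<lambda>U. U \<subseteq> range (torus_proj L) \<and> open (torus_proj L -` U))"
    unfolding istopology_def by (auto simp: vimage_Union)
  then show ?thesis
    unfolding torus_def by (simp add: topology_inverse')
qed

lemma topspace_torus: "topspace (torus L) = range (torus_proj L)"
proof
  show "topspace (torus L) \<subseteq> range (torus_proj L)"
    using openin_torus openin_topspace by blast
  have "torus_proj L -` range (torus_proj L) = UNIV" by auto
  then have "openin (torus L) (range (torus_proj L))"
    by (simp add: openin_torus)
  then show "range (torus_proj L) \<subseteq> topspace (torus L)"
    by (rule openin_subset)
qed

lemma quotient_map_torus_proj: "quotient_map euclidean (torus L) (torus_proj L)"
  unfolding quotient_map_def by (auto simp: topspace_torus openin_torus vimage_def)

section \<open>Differential calculus in the plane\<close>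

definition partial_deriv :: "2 \<Rightarrow> (real^2 \<Rightarrow> real) \<Rightarrow> real^2 \<Rightarrow> real" where
  "partial_deriv i g x = deriv (\<lambda>t. g (x + t *\<^sub>R axis i 1)) 0"

definition gradient :: "(real^2 \<Rightarrow> real) \<Rightarrow> real^2 \<Rightarrow> real^2" where
  "gradient g x = (\<chi> i. partial_deriv i g x)"

definition laplacian :: "(real^2 \<Rightarrow> real) \<Rightarrow> real^2 \<Rightarrow> real" where
  "laplacian g x = (\<Sum>i\<in>UNIV. partial_deriv i (partial_deriv i g) x)"

text \<open>The class \<open>C\<^sup>k(S)\<close> for an open set \<open>S\<close>.\<close>

primrec Ck_on :: "nat \<Rightarrow> (real^2) set \<Rightarrow> (real^2 \<Rightarrow> real) \<Rightarrow> bool" where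
  "Ck_on 0 S g \<longleftrightarrow> continuous_on S g"
| "Ck_on (Suc k) S g \<longleftrightarrow>
    (\<forall>x\<in>S. g differentiable (at x)) \<and> (\<forall>i. Ck_on k S (partial_deriv i g))"

text \<open>The class \<open>C\<^sup>k\<close> on the closure of an open set \<open>S\<close>: all derivatives of order at most \<open>k\<close>
  exist in \<open>S\<close> and extend continuously to \<open>closure S\<close>. The extension of \<open>g\<close> itself is required
  to be \<open>g\<close>, whereas the values of \<open>partial_deriv\<close> outside \<open>S\<close> are never used.\<close>

definition extends_to_closure :: "(real^2) set \<Rightarrow> (real^2 \<Rightarrow> real) \<Rightarrow> bool" where
  "extends_to_closure S g \<longleftrightarrow> (\<exists>h. continuous_on (closure S) h \<and> (\<forall>x\<in>S. h x = g x))"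

primrec Ck_extends :: "nat \<Rightarrow> (real^2) set \<Rightarrow> (real^2 \<Rightarrow> real) \<Rightarrow> bool" where
  "Ck_extends 0 S g \<longleftrightarrow> extends_to_closure S g"
| "Ck_extends (Suc k) S g \<longleftrightarrow> extends_to_closure S g \<and>
    (\<forall>x\<in>S. g differentiable (at x)) \<and> (\<forall>i. Ck_extends k S (partial_deriv i g))"

definition Ck_on_closure :: "nat \<Rightarrow> (real^2) set \<Rightarrow> (real^2 \<Rightarrow> real) \<Rightarrow> bool" where
  "Ck_on_closure k S g \<longleftrightarrow> continuous_on (closure S) g \<and> Ck_extends k S g"

text \<open>The continuous extension of the gradient from \<open>S\<close> to a boundary point \<open>x\<close> of \<open>S\<close>.\<close>

definition boundary_gradient :: "(real^2) set \<Rightarrow> (real^2 \<Rightarrow> real) \<Rightarrow> real^2 \<Rightarrow> real^2" where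
  "boundary_gradient S g x = Lim (at x within S) (gradient g)"

section \<open>Boundaries of class \<open>C\<^sup>2\<close> and the outward normal\<close>

definition C2_real :: "(real \<Rightarrow> real) \<Rightarrow> bool" where
  "C2_real \<gamma> \<longleftrightarrow> (\<forall>t. \<gamma> differentiable (at t)) \<and> deriv \<gamma> C1_differentiable_on UNIV"

text \<open>Near \<open>x\<close>, in the orthonormal coordinates given by \<open>e1, e2\<close>, the set \<open>S\<close> is the part of
  the disc lying below the graph of \<open>\<gamma>\<close>.\<close>

definition local_subgraph ::
    "(real^2) set \<Rightarrow> real^2 \<Rightarrow> real^2 \<Rightarrow> real^2 \<Rightarrow> (real \<Rightarrow> real) \<Rightarrow> bool" where
  "local_subgraph S x e1 e2 \<gamma> \<longleftrightarrow>
     norm e1 = 1 \<and> norm e2 = 1 \<and> e1 \<bullet> e2 = 0 \<and> C2_real \<gamma> \<and>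
     (\<exists>r>0. S \<inter> ball x r = {y \<in> ball x r. y \<bullet> e2 < \<gamma> (y \<bullet> e1)})"

definition C2_boundary :: "(real^2) set \<Rightarrow> bool" where
  "C2_boundary S \<longleftrightarrow> (\<forall>x\<in>frontier S. \<exists>e1 e2 \<gamma>. local_subgraph S x e1 e2 \<gamma>)"

text \<open>The normal to the graph pointing away from the subgraph, normalised by \<open>sgn v = v / norm v\<close>.\<close>

definition outward_unit_normal :: "(real^2) set \<Rightarrow> real^2 \<Rightarrow> real^2 \<Rightarrow> bool" where
  "outward_unit_normal S x \<nu> \<longleftrightarrow> x \<in> frontier S \<and>
     (\<exists>e1 e2 \<gamma>. local_subgraph S x e1 e2 \<gamma> \<and> \<nu> = sgn (e2 - deriv \<gamma> (x \<bullet> e1) *\<^sub>R e1))"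

lemma local_subgraph_boundary:
  assumes g: "local_subgraph S x e1 e2 \<gamma>" and x: "x \<in> frontier S"
  shows "x \<bullet> e2 = \<gamma> (x \<bullet> e1)"
proof -
  from g obtain r where r: "r > 0" "S \<inter> ball x r = {y \<in> ball x r. y \<bullet> e2 < \<gamma> (y \<bullet> e1)}"
    and \<gamma>: "\<And>t. \<gamma> differentiable (at t)"
    unfolding local_subgraph_def C2_real_def by blast
  have c\<gamma>: "continuous_on UNIV \<gamma>"
    using \<gamma> by (simp add: continuous_on_eq_continuous_at differentiable_imp_continuous_within)
  have c: "continuous_on UNIV (\<lambda>y. \<gamma> (y \<bullet> e1))"
    by (rule continuous_on_compose2[OF c\<gamma>]) (auto intro!: continuous_intros)
  have o1: "open {y. y \<bullet> e2 < \<gamma> (y \<bullet> e1)}" and o2: "open {y. \<gamma> (y \<bullet> e1) < y \<bullet> e2}"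
    by (intro open_Collect_less c continuous_intros)+
  show ?thesis
  proof (rule ccontr)
    assume "x \<bullet> e2 \<noteq> \<gamma> (x \<bullet> e1)"
    then consider "x \<bullet> e2 < \<gamma> (x \<bullet> e1)" | "\<gamma> (x \<bullet> e1) < x \<bullet> e2" by linarith
    then show False
    proof cases
      case 1
      have "open (ball x r \<inter> {y. y \<bullet> e2 < \<gamma> (y \<bullet> e1)})" using o1 by auto
      moreover have "ball x r \<inter> {y. y \<bullet> e2 < \<gamma> (y \<bullet> e1)} \<subseteq> S" using r(2) by blast
      ultimately have "x \<in> interior S" using 1 r(1) by (intro interiorI) auto
      then show False using x by (simp add: frontier_def)
    next
      case 2
      have "open (ball x r \<inter> {y. \<gamma> (y \<bullet> e1) < y \<bullet> e2})" using o2 by auto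
      moreover have "ball x r \<inter> {y. \<gamma> (y \<bullet> e1) < y \<bullet> e2} \<inter> S = {}"
      proof -
        have "\<not> \<gamma> (y \<bullet> e1) < y \<bullet> e2" if "y \<in> S" "y \<in> ball x r" for y
        proof -
          have "y \<in> {y \<in> ball x r. y \<bullet> e2 < \<gamma> (y \<bullet> e1)}" using that r(2) by blast
          then show ?thesis by simp
        qed
        then show ?thesis by blast
      qed
      ultimately have "ball x r \<inter> {y. \<gamma> (y \<bullet> e1) < y \<bullet> e2} \<inter> closure S = {}"
        by (simp add: open_Int_closure_eq_empty)
      moreover have "x \<in> closure S" using x by (simp add: frontier_def)
      moreover have "x \<in> ball x r \<inter> {y. \<gamma> (y \<bullet> e1) < y \<bullet> e2}" using 2 r(1) by simp
      ultimately show False by blast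
    qed
  qed
qed

lemma outward_unit_normal_sides:
  assumes "outward_unit_normal S x \<nu>"
  shows "norm \<nu> = 1"
    and "w \<bullet> \<nu> < 0 \<Longrightarrow> \<exists>d>0. \<forall>t. 0 < t \<and> t < d \<longrightarrow> x + t *\<^sub>R w \<in> S"
    and "w \<bullet> \<nu> > 0 \<Longrightarrow> \<exists>d>0. \<forall>t. 0 < t \<and> t < d \<longrightarrow> x + t *\<^sub>R w \<notin> S"
proof -
  from assms obtain e1 e2 \<gamma> where x: "x \<in> frontier S" and g: "local_subgraph S x e1 e2 \<gamma>"
    and \<nu>: "\<nu> = sgn (e2 - deriv \<gamma> (x \<bullet> e1) *\<^sub>R e1)"
    unfolding outward_unit_normal_def by blast
  define n where "n = e2 - deriv \<gamma> (x \<bullet> e1) *\<^sub>R e1"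
  from g obtain r where r: "r > 0" "S \<inter> ball x r = {y \<in> ball x r. y \<bullet> e2 < \<gamma> (y \<bullet> e1)}"
    and \<gamma>: "\<And>t. \<gamma> differentiable (at t)" and e: "norm e2 = 1" "e1 \<bullet> e2 = 0"
    unfolding local_subgraph_def C2_real_def by blast
  have "n \<bullet> e2 = 1" using e by (simp add: n_def inner_diff_left dot_square_norm)
  then have n0: "n \<noteq> 0" by auto
  then show "norm \<nu> = 1" using \<nu> by (simp add: n_def norm_sgn)
  have w\<nu>: "w \<bullet> \<nu> = (w \<bullet> n) / norm n"
    using \<nu> by (simp add: n_def sgn_div_norm divide_inverse mult.commute)
  define \<phi> where "\<phi> t = (x + t *\<^sub>R w) \<bullet> e2 - \<gamma> ((x + t *\<^sub>R w) \<bullet> e1)" for t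
  have \<phi>0: "\<phi> 0 = 0" using local_subgraph_boundary[OF g x] by (simp add: \<phi>_def)
  have d\<gamma>: "(\<gamma> has_real_derivative deriv \<gamma> (x \<bullet> e1)) (at (x \<bullet> e1))"
    using \<gamma> by (simp add: DERIV_deriv_iff_real_differentiable)
  have lin: "((\<lambda>t. x \<bullet> e + t * (w \<bullet> e)) has_real_derivative w \<bullet> e) (at 0)" for e
    by (auto intro!: derivative_eq_intros)
  have "((\<lambda>t. \<gamma> (x \<bullet> e1 + t * (w \<bullet> e1))) has_real_derivative
      deriv \<gamma> (x \<bullet> e1) * (w \<bullet> e1)) (at 0)"
    using DERIV_chain2[of \<gamma> "deriv \<gamma> (x \<bullet> e1)" "\<lambda>t. x \<bullet> e1 + t * (w \<bullet> e1)" 0, OF _ lin] d\<gamma>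
    by simp
  from DERIV_diff[OF lin[of e2] this]
  have d\<phi>: "(\<phi> has_real_derivative w \<bullet> n) (at 0)"
    by (simp add: \<phi>_def[abs_def] n_def inner_add_left inner_diff_right)
  have inb: "x + t *\<^sub>R w \<in> ball x r" if "0 < t" "t < r / (norm w + 1)" for t
  proof -
    have "t * norm w \<le> t * (norm w + 1)" using that by (simp add: mult_left_mono)
    also have "\<dots> < r" using that by (simp add: pos_less_divide_eq add_nonneg_pos)
    finally show ?thesis using that by (simp add: dist_norm)
  qed
  have rp: "r / (norm w + 1) > 0" using r(1) by (simp add: add_nonneg_pos)
  have rS: "y \<in> S \<longleftrightarrow> y \<bullet> e2 < \<gamma> (y \<bullet> e1)" if "y \<in> ball x r" for y
    using r(2) that by blast
  have iff: "x + t *\<^sub>R w \<in> S \<longleftrightarrow> \<phi> t < 0" if "0 < t" "t < r / (norm w + 1)" for t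
    using rS[OF inb[OF that]] unfolding \<phi>_def by linarith
  show "\<exists>d>0. \<forall>t. 0 < t \<and> t < d \<longrightarrow> x + t *\<^sub>R w \<in> S" if "w \<bullet> \<nu> < 0"
  proof -
    have "w \<bullet> n < 0" using that w\<nu> n0 by (simp add: divide_less_0_iff)
    from DERIV_neg_dec_right[OF d\<phi> this] obtain d where
      d: "d > 0" "\<And>h. 0 < h \<Longrightarrow> h < d \<Longrightarrow> \<phi> h < 0" using \<phi>0 by auto
    have "x + t *\<^sub>R w \<in> S" if "0 < t" "t < min d (r / (norm w + 1))" for t
      using iff[of t] d(2)[of t] that by (simp only: min_less_iff_conj)
    moreover have "0 < min d (r / (norm w + 1))" using d(1) rp by (simp only: min_less_iff_conj)
    ultimately show ?thesis by blast
  qed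
  show "\<exists>d>0. \<forall>t. 0 < t \<and> t < d \<longrightarrow> x + t *\<^sub>R w \<notin> S" if "w \<bullet> \<nu> > 0"
  proof -
    have "w \<bullet> n > 0" using that w\<nu> n0 by (simp add: zero_less_divide_iff)
    from DERIV_pos_inc_right[OF d\<phi> this] obtain d where
      d: "d > 0" "\<And>h. 0 < h \<Longrightarrow> h < d \<Longrightarrow> 0 < \<phi> h" using \<phi>0 by auto
    have "x + t *\<^sub>R w \<notin> S" if "0 < t" "t < min d (r / (norm w + 1))" for t
      using iff[of t] d(2)[of t] that by (simp add: not_less)
    moreover have "0 < min d (r / (norm w + 1))" using d(1) rp by (simp only: min_less_iff_conj)
    ultimately show ?thesis by blast
  qed
qed

lemma outward_unit_normal_unique:
  assumes "outward_unit_normal S x \<mu>" and "outward_unit_normal S x \<nu>"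
  shows "\<mu> = \<nu>"
proof (rule ccontr)
  assume ne: "\<mu> \<noteq> \<nu>"
  have n: "\<mu> \<bullet> \<mu> = 1" "\<nu> \<bullet> \<nu> = 1"
    using outward_unit_normal_sides(1) assms by (auto simp: dot_square_norm)
  have "(\<mu> - \<nu>) \<bullet> (\<mu> - \<nu>) > 0" using ne by simp
  then have "\<mu> \<bullet> \<nu> < 1" using n by (simp add: inner_diff inner_commute)
  then have "(\<nu> - \<mu>) \<bullet> \<mu> < 0" "(\<nu> - \<mu>) \<bullet> \<nu> > 0"
    using n inner_commute[of \<mu> \<nu>] by (simp_all only: inner_diff_left)
  then obtain c d where cd: "c > 0" "d > 0"
    "\<And>t. 0 < t \<Longrightarrow> t < c \<Longrightarrow> x + t *\<^sub>R (\<nu> - \<mu>) \<in> S"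
    "\<And>t. 0 < t \<Longrightarrow> t < d \<Longrightarrow> x + t *\<^sub>R (\<nu> - \<mu>) \<notin> S"
    using outward_unit_normal_sides(2)[OF assms(1)] outward_unit_normal_sides(3)[OF assms(2)]
    by metis
  have "0 < min c d / 2" "min c d / 2 < c" "min c d / 2 < d"
    using cd(1,2) by (auto simp: min_def)
  then show False using cd(3,4) by blast
qed

section \<open>Strict convexity\<close>

definition strictly_convex :: "(real^2) set \<Rightarrow> bool" where
  "strictly_convex K \<longleftrightarrow>
     (\<forall>x\<in>K. \<forall>y\<in>K. x \<noteq> y \<longrightarrow> open_segment x y \<subseteq> interior K)"

definition torus_component_strictly_convex :: "(real^2) set \<Rightarrow> (real^2) set set \<Rightarrow> bool" where
  "torus_component_strictly_convex L C \<longleftrightarrow>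
     (\<forall>K \<in> components (torus_proj L -` C). strictly_convex K)"

end

theory Submission
  imports Defs
begin

text \<open>Let \<open>P = |\<nabla>u|\<^sup>2 + 2 F(u)\<close> with \<open>F' = f\<close>, \<open>F(0) = 0\<close>. In dimension two \<open>P\<close> satisfies, away from the
  critical points of \<open>u\<close>, a linear elliptic equation without zero-order term. At critical points
  \<open>P = 2 F(u) < \<alpha>\<^sup>2\<close>, and \<open>P = \<alpha>\<^sup>2\<close> on the boundary, so by the strong maximum principle \<open>P < \<alpha>\<^sup>2\<close> inside
  and by Hopf's lemma \<open>P\<close> has positive outward normal derivative on the boundary. Expressed through the
  boundary conditions this derivative is \<open>-2 \<alpha>\<^sup>2 \<kappa>\<close>, where \<open>\<kappa>\<close> is the curvature of the boundary as seen from the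
  domain; hence the complement is locally strictly convex. In a connected closed set \<open>K\<close> of this
  kind, segments have their interior in the interior of \<open>K\<close>, so the set of points visible from a
  given point of \<open>K\<close> is open and closed in \<open>K\<close>, and \<open>K\<close> is strictly convex.\<close>

section \<open>Hopf's lemma and the strong maximum principle\<close>

text \<open>Dimension two enters through the Hessian H of u. Eliminating f by the equation gives
  grad P = 2 (H - tr H) grad u = -2 cof(H) grad u. Rows of the cofactor matrix of a Hessian are
  divergence-free, so the Laplacian of P is -4 det H; Cayley-Hamilton, H (H - tr H) = -det H, shows
  that this is also the scalar product of grad P with 2 H grad u / |grad u|^2. That drift blows up
  at critical points, so the maximum principle is applied only near points with nonzero gradient.
  Two obstacles shape the rest. The derivatives of u are merely continuous up to the boundary, so
  boundary derivatives are limits from inside: Hopf's lemma is stated as a linear decay inequality,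
  and chain rules along the boundary pass through inner curves. And the work is done on the preimage
  of the domain in the plane, which is unbounded and can be disconnected; maxima are taken over a
  compact period cell, and connectedness is used for lattice-invariant sets. The strict hypothesis
  at a boundary point, where u = 0, forces \<alpha> < 0.\<close>

lemma interior_max_second_order:
  fixes w :: "'a::euclidean_space \<Rightarrow> real"
  assumes A: "open A" "y \<in> A"
    and w: "\<And>x. x \<in> A \<Longrightarrow> (w has_derivative (\<lambda>h. W x \<bullet> h)) (at x)"
    and W: "(W has_derivative W') (at y)"
    and max: "\<And>x. x \<in> A \<Longrightarrow> w x \<le> w y"
  shows "W y = 0" and "W' i \<bullet> i \<le> 0"
proof -
  have "(\<lambda>h. W y \<bullet> h) = (\<lambda>h. 0)"
    using differential_zero_maxmin[OF A(2,1) w[OF A(2)]] max by blast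
  then have "W y \<bullet> W y = 0" by meson
  then show W0: "W y = 0" by simp
  show "W' i \<bullet> i \<le> 0"
  proof (rule ccontr)
    assume neg: "\<not> W' i \<bullet> i \<le> 0"
    \<comment> \<open>Slope of \<open>w\<close> in direction \<open>i\<close>. It vanishes at 0 with
      positive derivative there, hence is positive just after 0, and the mean value theorem lifts
      \<open>w\<close> above its maximum.\<close>
    define \<psi> where "\<psi> t = W (y + t *\<^sub>R i) \<bullet> i" for t
    interpret W': bounded_linear W' by (rule has_derivative_bounded_linear[OF W])
    have "((\<lambda>t. W (y + t *\<^sub>R i)) has_derivative (\<lambda>t. W' (t *\<^sub>R i))) (at 0)"
      by (rule has_derivative_compose[where f = "\<lambda>t. y + t *\<^sub>R i" and g = W])
        (use W in \<open>auto intro!: derivative_eq_intros\<close>)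
    then have "(\<psi> has_derivative (\<lambda>t. W' (t *\<^sub>R i) \<bullet> i)) (at 0)"
      unfolding \<psi>_def by (rule has_derivative_inner_left)
    then have "(\<psi> has_real_derivative (W' i \<bullet> i)) (at 0)"
      unfolding has_field_derivative_def by (simp add: W'.scaleR mult.commute[of _ "W' i \<bullet> i"])
    from DERIV_pos_inc_right[OF this] neg obtain d
      where d: "d > 0" "\<And>h. 0 < h \<Longrightarrow> h < d \<Longrightarrow> 0 < \<psi> h"
      by (auto simp: \<psi>_def W0)
    obtain e where e: "e > 0" "ball y e \<subseteq> A" using A openE by metis
    define h where "h = min (d/2) (e / (2 * (norm i + 1)))"
    have h: "0 < h" "h < d" using d e by (auto simp: h_def add_nonneg_pos)
    have inA: "y + t *\<^sub>R i \<in> A" if "0 \<le> t" "t \<le> h" for t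
    proof -
      have "t \<le> e / (2 * (norm i + 1))" using that by (simp add: h_def)
      then have "t * (2 * (norm i + 1)) \<le> e"
        by (simp add: pos_le_divide_eq add_nonneg_pos)
      moreover have "t * norm i \<le> t * (norm i + 1)" using that by (simp add: mult_left_mono)
      ultimately have "t * norm i < e" using e by argo
      then show ?thesis using e that by (auto simp: dist_norm)
    qed
    have "((\<lambda>t. w (y + t *\<^sub>R i)) has_real_derivative \<psi> t) (at t)" if "0 \<le> t" "t \<le> h" for t
    proof -
      have "((\<lambda>t. w (y + t *\<^sub>R i)) has_derivative (\<lambda>s. W (y + t *\<^sub>R i) \<bullet> (s *\<^sub>R i))) (at t)"
        by (rule has_derivative_compose[where f = "\<lambda>t. y + t *\<^sub>R i" and g = w])
          (use w[OF inA[OF that]] in \<open>auto intro!: derivative_eq_intros\<close>)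
      then show ?thesis unfolding has_field_derivative_def \<psi>_def by (simp add: mult.commute[of _ "W (y + t *\<^sub>R i) \<bullet> i"])
    qed
    from MVT2[OF h(1) this] obtain z where z: "0 < z" "z < h"
      "w (y + h *\<^sub>R i) - w (y + 0 *\<^sub>R i) = (h - 0) * \<psi> z" by blast
    have "0 < h * \<psi> z" using z h d(2)[of z] by simp
    then have "w y < w (y + h *\<^sub>R i)" using z(3) by simp
    moreover have "y + h *\<^sub>R i \<in> A" using inA h by simp
    ultimately show False using max by fastforce
  qed
qed

lemma gaussian_second_order:
  fixes a :: real
  fixes c :: "'a::euclidean_space"
  defines "E \<equiv> \<lambda>x. exp (- a * ((x - c) \<bullet> (x - c)))"
  shows "(E has_derivative (\<lambda>h. ((- 2 * a * E x) *\<^sub>R (x - c)) \<bullet> h)) (at x)"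
    and "((\<lambda>x. (- 2 * a * E x) *\<^sub>R (x - c)) has_derivative
          (\<lambda>h. (- 2 * a * E x) *\<^sub>R h + (4 * a\<^sup>2 * E x * ((x - c) \<bullet> h)) *\<^sub>R (x - c))) (at x)"
proof -
  show 1: "(E has_derivative (\<lambda>h. ((- 2 * a * E x) *\<^sub>R (x - c)) \<bullet> h)) (at x)"
    unfolding E_def
    by (auto intro!: derivative_eq_intros simp: fun_eq_iff inner_commute algebra_simps)
  show "((\<lambda>x. (- 2 * a * E x) *\<^sub>R (x - c)) has_derivative
          (\<lambda>h. (- 2 * a * E x) *\<^sub>R h + (4 * a\<^sup>2 * E x * ((x - c) \<bullet> h)) *\<^sub>R (x - c))) (at x)"
    apply (rule derivative_eq_intros 1 refl)+
    apply (auto simp: fun_eq_iff power2_eq_square algebra_simps)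
    done
qed

text \<open>The barrier \<open>exp (-a |x - c|\<^sup>2) - exp (-a R\<^sup>2)\<close> is compared with \<open>w\<close> in the lens
  \<open>cball c R \<inter> cball x0 \<rho>\<close>; on that set \<open>|x - c|\<close> is bounded below since \<open>\<rho> < R\<close>.\<close>

lemma hopf_boundary_point:
  fixes w :: "'a::euclidean_space \<Rightarrow> real"
  assumes R: "0 < \<rho>" "\<rho> < R" "dist x0 c = R"
    and cont: "continuous_on (cball c R \<inter> cball x0 \<rho>) w"
    and less: "\<And>x. x \<in> cball c R \<inter> cball x0 \<rho> \<Longrightarrow> x \<noteq> x0 \<Longrightarrow> w x < w x0"
    and w: "\<And>x. x \<in> ball c R \<inter> ball x0 \<rho> \<Longrightarrow> (w has_derivative (\<lambda>h. W x \<bullet> h)) (at x)"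
    and W: "\<And>x. x \<in> ball c R \<inter> ball x0 \<rho> \<Longrightarrow> (W has_derivative W' x) (at x)"
    and sub: "\<And>x. x \<in> ball c R \<inter> ball x0 \<rho> \<Longrightarrow> b x \<bullet> W x \<le> (\<Sum>i\<in>Basis. W' x i \<bullet> i)"
    and b: "\<And>x. x \<in> ball c R \<inter> ball x0 \<rho> \<Longrightarrow> norm (b x) \<le> \<beta>"
  shows "\<exists>k>0. \<forall>t\<in>{0..\<rho>}. w (x0 - t *\<^sub>R ((x0 - c) /\<^sub>R R)) \<le> w x0 - k * t"
proof -
  define n where "n = real DIM('a)"
  define r0 where "r0 = R - \<rho>"
  \<comment> \<open>Makes the differential inequality for the barrier strict where |x - c| >=
    \<open>r0\<close>: there 2 a |x - c|^2 exceeds n + |b . (x - c)| by at least 1. The absolute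
    value keeps \<open>a\<close> positive without first producing a point that bounds
    \<open>\<beta>\<close> below.\<close>
  define a where "a = (n + \<bar>\<beta>\<bar> * R + 1) / (2 * r0\<^sup>2)"
  define E where "E = (\<lambda>x. exp (- a * ((x - c) \<bullet> (x - c))))"
  define B where "B x = E x - exp (- a * R\<^sup>2)" for x
  have r0: "0 < r0" using R by (simp add: r0_def)
  have Rp: "0 < R" using R by simp
  have num: "0 < n + \<bar>\<beta>\<bar> * R + 1" using Rp unfolding n_def by (smt (verit) of_nat_0_le_iff mult_nonneg_nonneg abs_ge_zero)
  then have a: "0 < a" using r0 by (simp add: a_def)
  have a2: "2 * a * r0\<^sup>2 = n + \<bar>\<beta>\<bar> * R + 1" using r0 by (simp add: a_def field_simps)
  have B1: "B x \<le> 1" for x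
  proof -
    have "E x \<le> 1" using a by (simp add: E_def)
    then show ?thesis unfolding B_def by (smt (verit) exp_gt_zero)
  qed
  let ?K = "cball c R \<inter> cball x0 \<rho>"
  have ray: "dist (x0 - t *\<^sub>R ((x0 - c) /\<^sub>R R)) c = R - t"
      "dist (x0 - t *\<^sub>R ((x0 - c) /\<^sub>R R)) x0 = t" if "0 \<le> t" "t \<le> \<rho>" for t
  proof -
    have "x0 - t *\<^sub>R ((x0 - c) /\<^sub>R R) - c = (1 - t / R) *\<^sub>R (x0 - c)"
      by (simp add: algebra_simps divide_inverse)
    then have "dist (x0 - t *\<^sub>R ((x0 - c) /\<^sub>R R)) c = \<bar>1 - t/R\<bar> * R"
      using R by (simp add: dist_norm)
    also have "\<dots> = R - t" using that R by (simp add: abs_if field_simps)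
    finally show "dist (x0 - t *\<^sub>R ((x0 - c) /\<^sub>R R)) c = R - t" .
    show "dist (x0 - t *\<^sub>R ((x0 - c) /\<^sub>R R)) x0 = t" using R that by (simp add: dist_norm)
  qed
  \<comment> \<open>Compactness of the face |x - x0| = \<open>\<rho>\<close> gives a uniform gap;
    scaling the barrier by this gap, with \<open>B\<close> at most 1, keeps the sum below
    \<open>w x0\<close> there.\<close>
  obtain \<epsilon> where \<epsilon>: "\<epsilon> > 0" "\<And>x. x \<in> ?K \<Longrightarrow> dist x x0 = \<rho> \<Longrightarrow> w x + \<epsilon> \<le> w x0"
  proof -
    let ?L = "cball c R \<inter> sphere x0 \<rho>"
    have "compact ?L" by (intro compact_Int compact_cball compact_sphere)
    moreover have "x0 - \<rho> *\<^sub>R ((x0 - c) /\<^sub>R R) \<in> ?L"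
      using ray[of \<rho>] R by (auto simp: dist_commute)
    moreover have "continuous_on ?L w" using cont by (rule continuous_on_subset) auto
    ultimately obtain z where z: "z \<in> ?L" "\<And>x. x \<in> ?L \<Longrightarrow> w x \<le> w z"
      using continuous_attains_sup[of ?L w] by blast
    have "z \<noteq> x0" using z R by auto
    then have "w z < w x0" using less[of z] z by auto
    moreover have "w x \<le> w z" if "x \<in> ?K" "dist x x0 = \<rho>" for x
      using z(2)[of x] that by (auto simp: dist_commute)
    ultimately show ?thesis using that[of "w x0 - w z"] by force
  qed
  define v where "v x = w x + \<epsilon> * B x" for x
  \<comment> \<open>A maximum point of \<open>v\<close> inside the lens contradicts the differential
    inequality; on the sphere around \<open>c\<close> the barrier vanishes; on the sphere around
    \<open>x0\<close> the gap \<open>\<epsilon>\<close> absorbs it.\<close>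
  have vle: "v x \<le> w x0" if "x \<in> ?K" for x
  proof -
    have "compact ?K" by (intro compact_Int compact_cball)
    moreover have "continuous_on ?K v" unfolding v_def B_def E_def
      by (intro continuous_intros cont)
    moreover have "?K \<noteq> {}" using \<open>x \<in> ?K\<close> by blast
    ultimately obtain y where y: "y \<in> ?K" "\<And>x. x \<in> ?K \<Longrightarrow> v x \<le> v y"
      using continuous_attains_sup[of ?K v] by blast
    have "v y \<le> w x0"
    proof -
      consider "y \<in> ball c R \<inter> ball x0 \<rho>" | "dist y c = R" | "dist y x0 = \<rho>"
      proof -
        have "dist y c \<le> R" "dist y x0 \<le> \<rho>" using y(1) by (auto simp: dist_commute)
        then have "dist y c < R \<and> dist y x0 < \<rho> \<or> dist y c = R \<or> dist y x0 = \<rho>" by linarith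
        moreover have "dist y c < R \<and> dist y x0 < \<rho> \<longleftrightarrow> y \<in> ball c R \<inter> ball x0 \<rho>"
          by (simp add: dist_commute)
        ultimately show ?thesis using that by blast
      qed
      then show ?thesis
      proof cases
        case 1
        define r where "r = norm (y - c)"
        have "R \<le> dist x0 y + dist y c" using R(3) dist_triangle by metis
        then have r: "r0 \<le> r" "r < R" using 1 by (auto simp: r_def r0_def dist_norm norm_minus_commute)
        define V where "V x = W x + \<epsilon> *\<^sub>R ((- 2 * a * E x) *\<^sub>R (x - c))" for x
        define V' where "V' h = W' y h + \<epsilon> *\<^sub>R ((- 2 * a * E y) *\<^sub>R h
            + (4 * a\<^sup>2 * E y * ((y - c) \<bullet> h)) *\<^sub>R (y - c))" for h
        have dB: "(B has_derivative (\<lambda>h. ((- 2 * a * E x) *\<^sub>R (x - c)) \<bullet> h)) (at x)" for x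
          unfolding B_def using has_derivative_diff[OF gaussian_second_order(1)[of a c x]
            has_derivative_const[of "exp (- a * R\<^sup>2)"]] unfolding E_def by simp
        have dv: "(v has_derivative (\<lambda>h. V x \<bullet> h)) (at x)" if "x \<in> ball c R \<inter> ball x0 \<rho>" for x
        proof -
          have "(v has_derivative (\<lambda>h. W x \<bullet> h + \<epsilon> * (((- 2 * a * E x) *\<^sub>R (x - c)) \<bullet> h))) (at x)"
            unfolding v_def by (intro has_derivative_add w that has_derivative_mult_right dB)
          moreover have "(\<lambda>h. V x \<bullet> h) = (\<lambda>h. W x \<bullet> h + \<epsilon> * (((- 2 * a * E x) *\<^sub>R (x - c)) \<bullet> h))"
            by (simp add: V_def inner_add_left inner_diff_left fun_eq_iff)
          ultimately show ?thesis by (simp only:)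
        qed
        have dV: "(V has_derivative V') (at y)"
          unfolding V_def V'_def
          using gaussian_second_order(2)[of a c y, folded E_def]
          unfolding E_def by (intro has_derivative_add W 1 has_derivative_scaleR_right)
        have "open (ball c R \<inter> ball x0 \<rho>)" by auto
        moreover have "v x \<le> v y" if "x \<in> ball c R \<inter> ball x0 \<rho>" for x using that y(2)[of x] by auto
        ultimately have so: "V y = 0" "V' i \<bullet> i \<le> 0" for i
          using interior_max_second_order[of "ball c R \<inter> ball x0 \<rho>" y v V V'] 1 dv dV by blast+
        have "(\<Sum>i\<in>Basis. V' i \<bullet> i) \<le> 0" by (intro sum_nonpos so(2))
        moreover have "(\<Sum>i\<in>Basis. V' i \<bullet> i) = (\<Sum>i\<in>Basis. W' y i \<bullet> i)
            + \<epsilon> * E y * (4 * a\<^sup>2 * r\<^sup>2 - 2 * a * n)"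
        proof -
          have "(\<Sum>i\<in>Basis. ((y - c) \<bullet> i) * ((y - c) \<bullet> i)) = r\<^sup>2"
            by (simp add: euclidean_inner[symmetric] r_def power2_norm_eq_inner)
          then have *: "(\<Sum>i\<in>Basis. k * (((y - c) \<bullet> i) * ((y - c) \<bullet> i))) = k * r\<^sup>2" for k
            by (simp add: sum_distrib_left[symmetric])
          have "V' i \<bullet> i = W' y i \<bullet> i - 2 * \<epsilon> * a * E y
              + (4 * \<epsilon> * a\<^sup>2 * E y) * (((y - c) \<bullet> i) * ((y - c) \<bullet> i))" if "i \<in> Basis" for i
            using that by (simp add: V'_def inner_add_left inner_Basis algebra_simps)
          then have "(\<Sum>i\<in>Basis. V' i \<bullet> i) = (\<Sum>i\<in>Basis. W' y i \<bullet> i - 2 * \<epsilon> * a * E y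
              + (4 * \<epsilon> * a\<^sup>2 * E y) * (((y - c) \<bullet> i) * ((y - c) \<bullet> i)))" by (rule sum.cong[OF refl])
          also have "\<dots> = (\<Sum>i\<in>Basis. W' y i \<bullet> i) - n * (2 * \<epsilon> * a * E y) + (4 * \<epsilon> * a\<^sup>2 * E y) * r\<^sup>2"
            by (simp only: sum.distrib sum_subtractf * sum_constant n_def)
          finally show ?thesis by (simp add: algebra_simps)
        qed
        moreover have "b y \<bullet> W y \<le> (\<Sum>i\<in>Basis. W' y i \<bullet> i)" using sub 1 .
        moreover have "b y \<bullet> W y = \<epsilon> * E y * (2 * a * (b y \<bullet> (y - c)))"
        proof -
          \<comment> \<open>The vanishing gradient of \<open>v\<close> turns the unknown gradient of
            \<open>w\<close> into an explicit multiple of y - c, so the drift term can be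
            bounded.\<close>
          have "W y = - (\<epsilon> *\<^sub>R ((- 2 * a * E y) *\<^sub>R (y - c)))"
            using so(1) unfolding V_def by (simp add: eq_neg_iff_add_eq_0)
          then show ?thesis by simp
        qed
        ultimately have "\<epsilon> * E y * (2 * a * (b y \<bullet> (y - c)) + (4 * a\<^sup>2 * r\<^sup>2 - 2 * a * n)) \<le> 0"
          unfolding distrib_left by linarith
        moreover have "\<epsilon> * E y > 0" using \<epsilon> by (simp add: E_def)
        ultimately have le0: "2 * a * (b y \<bullet> (y - c)) + (4 * a\<^sup>2 * r\<^sup>2 - 2 * a * n) \<le> 0"
          by (metis mult_pos_pos not_less)
        have "2 * a * (b y \<bullet> (y - c)) + (4 * a\<^sup>2 * r\<^sup>2 - 2 * a * n)
            = 2 * a * (b y \<bullet> (y - c) + 2 * a * r\<^sup>2 - n)"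
          by (simp add: algebra_simps power2_eq_square)
        with le0 have "2 * a * (b y \<bullet> (y - c) + 2 * a * r\<^sup>2 - n) \<le> 0" by simp
        moreover have "0 < 2 * a" using a by simp
        ultimately have "b y \<bullet> (y - c) + 2 * a * r\<^sup>2 - n \<le> 0" by (metis mult_pos_pos not_less)
        moreover have "\<bar>b y \<bullet> (y - c)\<bar> \<le> \<bar>\<beta>\<bar> * R"
        proof -
          have "\<bar>b y \<bullet> (y - c)\<bar> \<le> norm (b y) * r" unfolding r_def by (rule Cauchy_Schwarz_ineq2)
          also have "\<dots> \<le> \<bar>\<beta>\<bar> * R" using b[OF 1] r r0 by (intro mult_mono) auto
          finally show ?thesis .
        qed
        moreover have "2 * a * r0\<^sup>2 \<le> 2 * a * r\<^sup>2" using a r r0 by (simp add: power_mono)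
        ultimately show ?thesis using a2 by linarith
      next
        case 2
        then have "B y = 0" by (simp add: B_def E_def dist_norm power2_norm_eq_inner[symmetric])
        moreover have "w y \<le> w x0" using less[of y] y(1) by (cases "y = x0") auto
        ultimately show ?thesis by (simp add: v_def)
      next
        case 3
        have "\<epsilon> * B y \<le> \<epsilon>" using \<epsilon>(1) B1[of y] by (simp add: mult_left_le)
        then show ?thesis using \<epsilon>(2)[of y] y(1) 3 by (simp add: v_def)
      qed
    qed
    then show ?thesis using y(2)[OF that] by linarith
  qed
  \<comment> \<open>Slope of a linear lower bound for the barrier on the ray towards
    \<open>c\<close>: a (2 R t - t^2) >= a R t for 0 <= t <= R, and exp s - 1 >= s. A bound on
    increments makes sense even where \<open>w\<close> has no derivative at
    \<open>x0\<close>.\<close>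
  define k where "k = \<epsilon> * (exp (- a * R\<^sup>2) * (a * R))"
  have "k > 0" using \<epsilon> a Rp by (simp add: k_def)
  moreover have "w (x0 - t *\<^sub>R ((x0 - c) /\<^sub>R R)) \<le> w x0 - k * t" if "t \<in> {0..\<rho>}" for t
  proof -
    define x where "x = x0 - t *\<^sub>R ((x0 - c) /\<^sub>R R)"
    have t: "0 \<le> t" "t \<le> \<rho>" using that by auto
    have x: "x \<in> ?K" using ray[OF t] t R unfolding x_def[symmetric] by (auto simp: dist_commute)
    have "(x - c) \<bullet> (x - c) = (R - t)\<^sup>2"
      using ray(1)[OF t] unfolding x_def[symmetric] by (simp add: dist_norm power2_norm_eq_inner[symmetric])
    then have "E x = exp (- a * (R - t)\<^sup>2)" by (simp add: E_def)
    also have "\<dots> = exp (- a * R\<^sup>2) * exp (a * (2 * R * t - t\<^sup>2))"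
      by (simp add: exp_add[symmetric] power2_eq_square algebra_simps)
    finally have "B x = exp (- a * R\<^sup>2) * (exp (a * (2 * R * t - t\<^sup>2)) - 1)"
      by (simp add: B_def algebra_simps)
    moreover have "a * R * t \<le> exp (a * (2 * R * t - t\<^sup>2)) - 1"
    proof -
      have "t * t \<le> R * t" using t R by (intro mult_right_mono) auto
      then have "a * (R * t) \<le> a * (2 * R * t - t\<^sup>2)"
        using a by (intro mult_left_mono) (auto simp: power2_eq_square)
      moreover have "1 + a * (2 * R * t - t\<^sup>2) \<le> exp (a * (2 * R * t - t\<^sup>2))"
        by (rule exp_ge_add_one_self)
      ultimately show ?thesis unfolding mult.assoc[of a R t] by linarith
    qed
    ultimately have "exp (- a * R\<^sup>2) * (a * R * t) \<le> B x" by (simp add: mult_left_mono)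
    then have "\<epsilon> * (exp (- a * R\<^sup>2) * (a * R * t)) \<le> \<epsilon> * B x" using \<epsilon>(1) by (simp add: mult_left_mono)
    then have "k * t \<le> \<epsilon> * B x" by (simp add: k_def mult.assoc)
    then show ?thesis using vle[OF x] unfolding v_def x_def by linarith
  qed
  ultimately show ?thesis by blast
qed

text \<open>If the set of maximum points were not open, a ball free of maximum points would touch it
  at some \<open>x1\<close>; Hopf's lemma forces a nonzero slope there, while the gradient vanishes
  at an interior maximum. The inequality is asked for only near maximum points because the intended
  drift can be singular elsewhere; the conclusion is openness, which makes sense for a disconnected
  \<open>S\<close>.\<close>

lemma strong_maximum_principle:
  fixes w :: "'a::euclidean_space \<Rightarrow> real"
  assumes S: "open S"
    and le: "\<And>x. x \<in> S \<Longrightarrow> w x \<le> M"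
    and w: "\<And>x. x \<in> S \<Longrightarrow> (w has_derivative (\<lambda>h. W x \<bullet> h)) (at x)"
    and W: "\<And>x. x \<in> S \<Longrightarrow> (W has_derivative W' x) (at x)"
    and sub: "\<And>x. x \<in> S \<Longrightarrow> w x = M \<Longrightarrow> \<exists>r>0. \<exists>b \<beta>. \<forall>y \<in> ball x r \<inter> S.
      norm (b y) \<le> \<beta> \<and> b y \<bullet> W y \<le> (\<Sum>i\<in>Basis. W' y i \<bullet> i)"
  shows "open {x \<in> S. w x = M}"
proof (rule ccontr)
  let ?E = "{x \<in> S. w x = M}"
  assume "\<not> open ?E"
  then obtain x0 where x0: "x0 \<in> S" "w x0 = M" "\<And>e. e > 0 \<Longrightarrow> \<not> ball x0 e \<subseteq> ?E"
    unfolding open_contains_ball by blast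
  have cont: "continuous_on S w"
    using w by (meson continuous_at_imp_continuous_on has_derivative_continuous)
  obtain e where e: "e > 0" "cball x0 e \<subseteq> S"
    using S x0(1) open_contains_cball by metis
  \<comment> \<open>With \<open>y\<close> within e/4 of \<open>x0\<close>, the ball around
    \<open>y\<close> up to its nearest maximum point stays inside \<open>cball x0 (e/2)\<close>, so
    being nearest within that compact set is enough.\<close>
  obtain y where y: "y \<in> ball x0 (e/4)" "w y \<noteq> M"
    using x0(3)[of "e/4"] e by (auto simp: subset_eq)
  have Ecl: "compact {x \<in> cball x0 (e/2). w x = M}"
  proof -
    have "closedin (top_of_set (cball x0 (e/2))) {x \<in> cball x0 (e/2). w x = M}"
      using continuous_closedin_preimage_constant[of "cball x0 (e/2)" w M]
        continuous_on_subset[OF cont] e by (auto simp: subset_eq)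
    then show ?thesis using closedin_compact compact_cball by blast
  qed
  have "x0 \<in> {x \<in> cball x0 (e/2). w x = M}" using e x0 by simp
  then have "{x \<in> cball x0 (e/2). w x = M} \<noteq> {}" by blast
  from distance_attains_inf[OF compact_imp_closed[OF Ecl] this, of y]
  obtain x1 where "x1 \<in> {x \<in> cball x0 (e/2). w x = M}"
      "\<And>x. x \<in> {x \<in> cball x0 (e/2). w x = M} \<Longrightarrow> dist y x1 \<le> dist y x" by metis
  then have x1: "x1 \<in> cball x0 (e/2)" "w x1 = M"
      "\<And>x. x \<in> cball x0 (e/2) \<Longrightarrow> w x = M \<Longrightarrow> dist y x1 \<le> dist y x" by auto
  have x1S: "x1 \<in> S" using x1(1) e by (auto simp: subset_eq)
  define D where "D = dist y x1"
  have D: "0 < D" "D < e/4"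
    using x1(2) x1(3)[of x0] x0 e y by (auto simp: D_def dist_commute)
  have less: "x \<in> S \<and> w x < M" if "dist y x < D" for x
  proof -
    have "dist x0 x \<le> e/2" using dist_triangle[of x0 x y] that D y(1) by (auto simp: dist_commute)
    then have "x \<in> cball x0 (e/2)" "x \<in> S" using e by (auto simp: subset_eq)
    moreover have "w x \<noteq> M" using x1(3)[of x] \<open>x \<in> cball x0 (e/2)\<close> that by (auto simp: D_def)
    ultimately show ?thesis using le[of x] by auto
  qed
  obtain r b \<beta> where r: "r > 0" "\<And>z. z \<in> ball x1 r \<inter> S \<Longrightarrow>
      norm (b z) \<le> \<beta> \<and> b z \<bullet> W z \<le> (\<Sum>i\<in>Basis. W' z i \<bullet> i)"
    using sub[OF x1S x1(2)] by blast
  \<comment> \<open>The sphere around \<open>y\<close> may meet the maximum set in several points;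
    the ball of half the radius, internally tangent at \<open>x1\<close>, meets it only there, as
    Hopf's lemma demands.\<close>
  define c where "c = midpoint y x1"
  define R where "R = D/2"
  have R: "dist x1 c = R" "dist y c = R" by (simp_all add: c_def R_def D_def dist_midpoint dist_commute)
  obtain s where s: "s > 0" "cball x1 s \<subseteq> S" using S x1S open_contains_cball by metis
  define \<rho> where "\<rho> = min (min (r/2) s) (R/2)"
  have \<rho>: "0 < \<rho>" "\<rho> < R" "\<rho> < r" "\<rho> \<le> s" using r s D by (auto simp: \<rho>_def R_def)
  have inS: "x \<in> S" if "x \<in> cball x1 \<rho>" for x using that \<rho> s by (auto simp: subset_eq)
  have inside: "dist y x < D" if "dist c x \<le> R" "x \<noteq> x1" for x
  proof (rule ccontr)
    assume "\<not> dist y x < D"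
    moreover have "dist y x \<le> dist y c + dist c x" by (rule dist_triangle)
    ultimately have eq: "dist c x = R" "dist y x = D" using that R by (auto simp: R_def)
    \<comment> \<open>Equality in the triangle inequality puts \<open>c\<close> at the midpoint of
      \<open>y\<close> and \<open>x\<close>, as it is of \<open>y\<close> and \<open>x1\<close>, so
      \<open>x\<close> would be \<open>x1\<close>.\<close>
    then have "dist y x = dist y c + dist c x" using R by (simp add: R_def)
    then have "c = midpoint y x" using eq R by (simp add: midpoint_between between)
    then have "midpoint y x = midpoint y x1" by (simp add: c_def)
    then show False using that by (simp add: midpoint_eq_iff)
  qed
  have "\<exists>k>0. \<forall>t\<in>{0..\<rho>}. w (x1 - t *\<^sub>R ((x1 - c) /\<^sub>R R)) \<le> w x1 - k * t"
  proof (rule hopf_boundary_point[where W = W and W' = W' and b = b and \<beta> = \<beta>])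
    show "continuous_on (cball c R \<inter> cball x1 \<rho>) w"
      using cont by (rule continuous_on_subset) (use inS in blast)
    show "w x < w x1" if "x \<in> cball c R \<inter> cball x1 \<rho>" "x \<noteq> x1" for x
      using less[OF inside] that x1(2) by auto
    fix x assume x: "x \<in> ball c R \<inter> ball x1 \<rho>"
    have "x \<in> cball x1 \<rho>" using x by simp
    from inS[OF this] show "(w has_derivative (\<lambda>h. W x \<bullet> h)) (at x)" "(W has_derivative W' x) (at x)"
      using w W by blast+
    have "x \<in> ball x1 r \<inter> S" using inS[OF \<open>x \<in> cball x1 \<rho>\<close>] x \<rho> by auto
    from r(2)[OF this] show "b x \<bullet> W x \<le> (\<Sum>i\<in>Basis. W' x i \<bullet> i)" "norm (b x) \<le> \<beta>" by auto
  qed (use \<rho> R in auto)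
  then obtain k where k: "k > 0"
      "\<And>t. t \<in> {0..\<rho>} \<Longrightarrow> w (x1 - t *\<^sub>R ((x1 - c) /\<^sub>R R)) \<le> w x1 - k * t" by blast
  have "(\<lambda>h. W x1 \<bullet> h) = (\<lambda>h. 0)"
    using differential_zero_maxmin[OF x1S S w[OF x1S]] le x1(2) by blast
  then have "(w has_derivative (\<lambda>h. 0)) (at x1)" using w[OF x1S] by simp
  define n where "n = (x1 - c) /\<^sub>R R"
  have "((\<lambda>t. w (x1 - t *\<^sub>R n)) has_derivative (\<lambda>t. 0)) (at 0)"
    by (rule has_derivative_compose[where f = "\<lambda>t. x1 - t *\<^sub>R n" and g = w and g' = "\<lambda>h. 0"])
      (use \<open>(w has_derivative (\<lambda>h. 0)) (at x1)\<close> in \<open>auto intro!: derivative_eq_intros\<close>)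
  then have "((\<lambda>t. w (x1 - t *\<^sub>R n) + k * t) has_real_derivative k) (at 0)"
    unfolding has_field_derivative_def by (auto intro!: derivative_eq_intros simp: fun_eq_iff)
  from DERIV_pos_inc_right[OF this k(1)] obtain d where
    d: "d > 0" "\<And>h. 0 < h \<Longrightarrow> h < d \<Longrightarrow> w x1 < w (x1 - h *\<^sub>R n) + k * h" by auto
  have "0 < min (d/2) \<rho>" "min (d/2) \<rho> < d" "min (d/2) \<rho> \<in> {0..\<rho>}" using d \<rho> by auto
  then show False using d(2)[of "min (d/2) \<rho>"] k(2)[of "min (d/2) \<rho>"] unfolding n_def by linarith
qed

section \<open>Partial derivatives in the plane and the P-function\<close>

lemma partial_deriv_eq:
  assumes "(g has_derivative g') (at x)"
  shows "partial_deriv i g x = g' (axis i 1)"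
proof -
  interpret g': bounded_linear g' by (rule has_derivative_bounded_linear[OF assms])
  have "((\<lambda>t. g (x + t *\<^sub>R axis i 1)) has_derivative (\<lambda>t. g' (t *\<^sub>R axis i 1))) (at 0)"
    by (rule has_derivative_compose[where f = "\<lambda>t. x + t *\<^sub>R axis i 1" and g = g])
      (use assms in \<open>auto intro!: derivative_eq_intros\<close>)
  then have "((\<lambda>t. g (x + t *\<^sub>R axis i 1)) has_real_derivative g' (axis i 1)) (at 0)"
    unfolding has_field_derivative_def by (simp add: g'.scaleR mult.commute[of _ "g' (axis i 1)"])
  then show ?thesis unfolding partial_deriv_def by (rule DERIV_imp_deriv)
qed

lemma axis_plane_expansion: "(h :: real^2) = h $ 1 *\<^sub>R axis 1 1 + h $ 2 *\<^sub>R axis 2 1"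
  by (simp add: vec_eq_iff forall_2 axis_def)

lemma sum_Basis_plane: "(\<Sum>i\<in>(Basis :: (real^2) set). k i) = k (axis 1 1) + k (axis 2 1)"
proof -
  have B: "(Basis :: (real^2) set) = {axis 1 1, axis 2 1}"
    by (auto simp: Basis_vec_def UNIV_2)
  show ?thesis unfolding B by (subst sum.insert) (auto simp: axis_eq_axis)
qed

lemma inner_plane: "(x :: real^2) \<bullet> y = x $ 1 * y $ 1 + x $ 2 * y $ 2"
  by (simp add: inner_vec_def sum_2)

lemma has_derivative_gradient:
  assumes "g differentiable (at x)"
  shows "(g has_derivative (\<lambda>h. gradient g x \<bullet> h)) (at x)"
proof -
  obtain g' where g': "(g has_derivative g') (at x)" using assms unfolding differentiable_def by blast
  interpret g': bounded_linear g' by (rule has_derivative_bounded_linear[OF g'])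
  have "g' h = gradient g x \<bullet> h" for h
    by (subst axis_plane_expansion[of h])
      (simp add: g'.add g'.scaleR inner_plane gradient_def partial_deriv_eq[OF g'] axis_def)
  then have "g' = (\<lambda>h. gradient g x \<bullet> h)" by auto
  then show ?thesis using g' by simp
qed

lemma partial_deriv_transform:
  assumes "open S" "x \<in> S" "\<And>y. y \<in> S \<Longrightarrow> g y = h y"
  shows "partial_deriv i g x = partial_deriv i h x"
  unfolding partial_deriv_def
proof (rule deriv_cong_ev)
  have "open ((\<lambda>t. x + t *\<^sub>R axis i 1) -` S)" by (intro open_vimage assms continuous_intros)
  then have "\<forall>\<^sub>F t in nhds 0. t \<in> (\<lambda>t. x + t *\<^sub>R axis i 1) -` S"
    by (rule eventually_nhds_in_open) (simp add: assms(2))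
  then have "\<forall>\<^sub>F t in nhds 0. x + t *\<^sub>R axis i 1 \<in> S" by simp
  then show "\<forall>\<^sub>F t in nhds 0. g (x + t *\<^sub>R axis i 1) = h (x + t *\<^sub>R axis i 1)"
    by (rule eventually_mono) (rule assms(3))
qed simp

lemma has_real_derivative_partial:
  assumes "g differentiable (at (x + t *\<^sub>R axis i 1))"
  shows "((\<lambda>t. g (x + t *\<^sub>R axis i 1)) has_real_derivative partial_deriv i g (x + t *\<^sub>R axis i 1)) (at t)"
proof -
  have "((\<lambda>t. g (x + t *\<^sub>R axis i 1)) has_derivative
      (\<lambda>s. gradient g (x + t *\<^sub>R axis i 1) \<bullet> (s *\<^sub>R axis i 1))) (at t)"
    by (rule has_derivative_compose[where f = "\<lambda>t. x + t *\<^sub>R axis i 1" and g = g])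
      (use has_derivative_gradient[OF assms] in \<open>auto intro!: derivative_eq_intros\<close>)
  moreover have "(\<lambda>s. gradient g (x + t *\<^sub>R axis i 1) \<bullet> (s *\<^sub>R axis i 1))
      = (*) (partial_deriv i g (x + t *\<^sub>R axis i 1))"
    by (auto simp: gradient_def inner_axis fun_eq_iff)
  ultimately show ?thesis unfolding has_field_derivative_def by (simp only:)
qed

text \<open>The left side is symmetric in \<open>i\<close> and \<open>j\<close> whereas the right
  side fixes an order of differentiation; using it for both orders gives the symmetry of second
  derivatives. Radius 3 h leaves strict room, the points involved being at distance at most 2
  h.\<close>

lemma second_difference_mvt:
  fixes g :: "real^2 \<Rightarrow> real"
  assumes h: "0 < h" and S: "ball x (3 * h) \<subseteq> S"
    and g: "\<And>y. y \<in> S \<Longrightarrow> g differentiable (at y)"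
    and gi: "\<And>y. y \<in> S \<Longrightarrow> partial_deriv i g differentiable (at y)"
  shows "\<exists>z \<in> ball x (3 * h). g (x + h *\<^sub>R axis j 1 + h *\<^sub>R axis i 1) - g (x + h *\<^sub>R axis i 1)
      - g (x + h *\<^sub>R axis j 1) + g x = h * h * partial_deriv j (partial_deriv i g) z"
proof -
  have inb: "x + t *\<^sub>R axis i 1 + s *\<^sub>R axis j 1 \<in> ball x (3 * h)"
    if "0 \<le> t" "t \<le> h" "0 \<le> s" "s \<le> h" for s t
  proof -
    have "norm (t *\<^sub>R axis i 1 + s *\<^sub>R axis j 1 :: real^2) \<le> t + s"
      using that norm_triangle_ineq[of "t *\<^sub>R axis i 1" "s *\<^sub>R axis j 1 :: real^2"] by simp
    also have "\<dots> < 3 * h" using that h by simp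
    moreover have "dist x (x + t *\<^sub>R axis i 1 + s *\<^sub>R axis j 1) = norm (t *\<^sub>R axis i 1 + s *\<^sub>R axis j 1 :: real^2)"
      by (metis add.assoc add_diff_cancel_left' dist_commute dist_norm)
    ultimately show ?thesis by (simp only: mem_ball)
  qed
  define \<phi> where "\<phi> t = g ((x + h *\<^sub>R axis j 1) + t *\<^sub>R axis i 1) - g (x + t *\<^sub>R axis i 1)" for t
  define \<phi>' where "\<phi>' t = partial_deriv i g ((x + h *\<^sub>R axis j 1) + t *\<^sub>R axis i 1)
      - partial_deriv i g (x + t *\<^sub>R axis i 1)" for t
  have "DERIV \<phi> t :> \<phi>' t" if t: "0 \<le> t" "t \<le> h" for t
  proof -
    have "x + t *\<^sub>R axis i 1 + h *\<^sub>R axis j 1 \<in> S" "x + t *\<^sub>R axis i 1 + 0 *\<^sub>R axis j 1 \<in> S"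
      using inb[OF t, of h] inb[OF t, of 0] h S by auto
    then show ?thesis unfolding \<phi>_def \<phi>'_def
      by (intro DERIV_diff has_real_derivative_partial g) (simp_all add: algebra_simps)
  qed
  from MVT2[OF h this] obtain t where t: "0 < t" "t < h" "\<phi> h - \<phi> 0 = (h - 0) * \<phi>' t" by blast
  have "DERIV (\<lambda>s. partial_deriv i g ((x + t *\<^sub>R axis i 1) + s *\<^sub>R axis j 1)) s :>
      partial_deriv j (partial_deriv i g) ((x + t *\<^sub>R axis i 1) + s *\<^sub>R axis j 1)"
    if s: "0 \<le> s" "s \<le> h" for s
    using inb[of t s] s t S by (intro has_real_derivative_partial gi) auto
  from MVT2[OF h this] obtain s where s: "0 < s" "s < h"
    "partial_deriv i g ((x + t *\<^sub>R axis i 1) + h *\<^sub>R axis j 1) - partial_deriv i g ((x + t *\<^sub>R axis i 1) + 0 *\<^sub>R axis j 1)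
      = (h - 0) * partial_deriv j (partial_deriv i g) ((x + t *\<^sub>R axis i 1) + s *\<^sub>R axis j 1)" by blast
  have "\<phi>' t = h * partial_deriv j (partial_deriv i g) ((x + t *\<^sub>R axis i 1) + s *\<^sub>R axis j 1)"
    using s(3) by (simp add: \<phi>'_def algebra_simps)
  then show ?thesis using t(3) inb[of t s] t s
    by (intro bexI[of _ "(x + t *\<^sub>R axis i 1) + s *\<^sub>R axis j 1"]) (simp_all add: \<phi>_def)
qed

text \<open>One and the same difference quotient converges to both mixed derivatives. Symmetry has
  to be derived since \<open>Ck_on\<close> speaks of iterated partial derivatives.\<close>

lemma partial_deriv_commute:
  assumes S: "open S" "x \<in> S" and g: "Ck_on 2 S g"
  shows "partial_deriv i (partial_deriv j g) x = partial_deriv j (partial_deriv i g) x"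
proof -
  have d: "\<And>y. y \<in> S \<Longrightarrow> g differentiable (at y)"
      "\<And>y k. y \<in> S \<Longrightarrow> partial_deriv k g differentiable (at y)"
      "\<And>k l. continuous_on S (partial_deriv k (partial_deriv l g))"
    using g by (auto simp: numeral_2_eq_2)
  obtain e where e: "e > 0" "ball x e \<subseteq> S" using S openE by metis
  define h where "h n = e / (3 * real (Suc n))" for n
  have h: "0 < h n" "ball x (3 * h n) \<subseteq> S" for n
  proof -
    show "0 < h n" using e by (simp add: h_def)
    have "3 * h n \<le> e" using e by (simp add: h_def field_simps)
    then show "ball x (3 * h n) \<subseteq> S" using e subset_ball by blast
  qed
  have hlim: "(\<lambda>n. 3 * h n) \<longlonglongrightarrow> 0"
  proof -
    have "(\<lambda>n. e * inverse (real (Suc n))) \<longlonglongrightarrow> e * 0"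
      by (intro tendsto_intros LIMSEQ_inverse_real_of_nat)
    moreover have "3 * h n = e * inverse (real (Suc n))" for n by (simp add: h_def field_simps)
    ultimately show ?thesis by simp
  qed
  define q where "q n = (g (x + h n *\<^sub>R axis j 1 + h n *\<^sub>R axis i 1) - g (x + h n *\<^sub>R axis i 1)
      - g (x + h n *\<^sub>R axis j 1) + g x) / (h n * h n)" for n
  have lim: "q \<longlonglongrightarrow> partial_deriv k (partial_deriv l g) x" if kl: "{k, l} = {i, j}" for k l
  proof -
    have "\<exists>z \<in> ball x (3 * h n). q n = partial_deriv k (partial_deriv l g) z" for n
    proof -
      obtain z where "z \<in> ball x (3 * h n)" "g (x + h n *\<^sub>R axis k 1 + h n *\<^sub>R axis l 1)
          - g (x + h n *\<^sub>R axis l 1) - g (x + h n *\<^sub>R axis k 1) + g x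
          = h n * h n * partial_deriv k (partial_deriv l g) z"
        using second_difference_mvt[OF h d(1) d(2)] by blast
      moreover have "k = i \<and> l = j \<or> k = j \<and> l = i" using kl by (auto simp: doubleton_eq_iff)
      ultimately show ?thesis using h(1)[of n]
        by (intro bexI[of _ z]) (auto simp: q_def field_simps)
    qed
    then obtain z where z: "\<And>n. z n \<in> ball x (3 * h n)" "\<And>n. q n = partial_deriv k (partial_deriv l g) (z n)"
      by metis
    have "z \<longlonglongrightarrow> x"
      by (rule metric_tendsto_imp_tendsto[OF hlim])
        (use z(1) h(1) in \<open>auto simp: dist_commute less_imp_le intro!: always_eventually less_imp_le\<close>)
    moreover have "isCont (partial_deriv k (partial_deriv l g)) x"
      using d(3) S continuous_on_eq_continuous_at by blast
    ultimately have "(\<lambda>n. partial_deriv k (partial_deriv l g) (z n)) \<longlonglongrightarrow> partial_deriv k (partial_deriv l g) x"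
      by (rule isCont_tendsto_compose[rotated])
    moreover have "q = (\<lambda>n. partial_deriv k (partial_deriv l g) (z n))" using z(2) by auto
    ultimately show ?thesis by (simp only:)
  qed
  show ?thesis using LIMSEQ_unique[OF lim[of i j] lim[of j i]] by (simp add: insert_commute)
qed

section \<open>The P-function and its elliptic equation\<close>

definition P_function :: "(real \<Rightarrow> real) \<Rightarrow> (real^2 \<Rightarrow> real) \<Rightarrow> real^2 \<Rightarrow> real" where
  "P_function F u x = gradient u x \<bullet> gradient u x + 2 * F (u x)"

text \<open>On solutions of \<open>\<Delta>u + f(u) = 0\<close> this is the gradient of the P-function: the terms
  containing \<open>f\<close> have been eliminated by means of the equation.\<close>

definition P_gradient :: "(real^2 \<Rightarrow> real) \<Rightarrow> real^2 \<Rightarrow> real^2" where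
  "P_gradient u x = vector
    [2 * (partial_deriv 1 (partial_deriv 2 u) x * partial_deriv 2 u x
        - partial_deriv 2 (partial_deriv 2 u) x * partial_deriv 1 u x),
     2 * (partial_deriv 1 (partial_deriv 2 u) x * partial_deriv 1 u x
        - partial_deriv 1 (partial_deriv 1 u) x * partial_deriv 2 u x)]"

text \<open>With H the Hessian of u, this is 2 H grad u / |grad u|^2, the first-order coefficient in
  the equation for the P-function. At critical points the division by zero returns 0, and no claim
  is made there.\<close>

definition P_drift :: "(real^2 \<Rightarrow> real) \<Rightarrow> real^2 \<Rightarrow> real^2" where
  "P_drift u x = (2 / (gradient u x \<bullet> gradient u x)) *\<^sub>R vector
    [partial_deriv 1 (partial_deriv 1 u) x * partial_deriv 1 u x
        + partial_deriv 1 (partial_deriv 2 u) x * partial_deriv 2 u x,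
     partial_deriv 1 (partial_deriv 2 u) x * partial_deriv 1 u x
        + partial_deriv 2 (partial_deriv 2 u) x * partial_deriv 2 u x]"

lemma P_function_has_derivative:
  assumes S: "open S" "x \<in> S" and u: "Ck_on 2 S u"
    and F: "\<And>t. (F has_real_derivative f t) (at t)"
    and eq: "laplacian u x + f (u x) = 0"
  shows "(P_function F u has_derivative (\<lambda>h. P_gradient u x \<bullet> h)) (at x)"
proof -
  have d: "u differentiable (at x)" "partial_deriv i u differentiable (at x)" for i
    using u S(2) by (auto simp: numeral_2_eq_2)
  note dp = has_derivative_gradient[OF d(2)]
  have "((\<lambda>x. F (u x)) has_derivative (\<lambda>h. gradient u x \<bullet> h * f (u x))) (at x)"
    by (rule has_derivative_compose[OF has_derivative_gradient[OF d(1)]])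
      (use F[of "u x"] in \<open>simp add: has_field_derivative_def mult.commute[of _ "f (u x)"]\<close>)
  then have der: "((\<lambda>x. partial_deriv 1 u x * partial_deriv 1 u x + partial_deriv 2 u x * partial_deriv 2 u x
      + 2 * F (u x)) has_derivative (\<lambda>h.
      (partial_deriv 1 u x * (gradient (partial_deriv 1 u) x \<bullet> h) + (gradient (partial_deriv 1 u) x \<bullet> h) * partial_deriv 1 u x)
      + (partial_deriv 2 u x * (gradient (partial_deriv 2 u) x \<bullet> h) + (gradient (partial_deriv 2 u) x \<bullet> h) * partial_deriv 2 u x)
      + 2 * (gradient u x \<bullet> h * f (u x)))) (at x)" (is "(_ has_derivative ?D) _")
    by (intro has_derivative_add has_derivative_mult dp has_derivative_mult_right)
  have P: "P_function F u = (\<lambda>x. partial_deriv 1 u x * partial_deriv 1 u x + partial_deriv 2 u x * partial_deriv 2 u x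
      + 2 * F (u x))"
    by (simp add: fun_eq_iff P_function_def inner_plane gradient_def)
  \<comment> \<open>The equation trades \<open>f\<close> for minus the Laplacian, so that the
    gradient contains only derivatives of u and can be differentiated once more when u is of class
    C^3.\<close>
  have f: "f (u x) = - (partial_deriv 1 (partial_deriv 1 u) x + partial_deriv 2 (partial_deriv 2 u) x)"
    using eq by (simp add: laplacian_def sum_2)
  have s: "partial_deriv 2 (partial_deriv 1 u) x = partial_deriv 1 (partial_deriv 2 u) x"
    by (rule partial_deriv_commute[OF S u])
  have "?D h = P_gradient u x \<bullet> h" for h
    by (simp add: P_gradient_def inner_plane gradient_def vector_2 f s algebra_simps)
  then have "?D = (\<lambda>h. P_gradient u x \<bullet> h)" by (rule ext)
  then show ?thesis using der unfolding P by (simp only:)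
qed

text \<open>The field is -2 cof(H) grad u with H the Hessian. The third derivatives cancel because
  the rows of cof(H) are divergence-free; what remains is -2 cof(H) : H = -4 det H. On solutions
  this is the Laplacian of the P-function.\<close>

lemma P_gradient_divergence:
  assumes S: "open S" "x \<in> S" and u: "Ck_on 3 S u"
  shows "\<exists>W'. (P_gradient u has_derivative W') (at x) \<and> (\<Sum>i\<in>Basis. W' i \<bullet> i) =
    4 * ((partial_deriv 1 (partial_deriv 2 u) x)\<^sup>2
      - partial_deriv 1 (partial_deriv 1 u) x * partial_deriv 2 (partial_deriv 2 u) x)"
proof -
  let ?u = "\<lambda>i. partial_deriv i u" and ?v = "\<lambda>i j. partial_deriv i (partial_deriv j u)"
  let ?w = "\<lambda>i j k. partial_deriv i (partial_deriv j (partial_deriv k u))"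
  have d: "?u i differentiable (at x)" "?v i j differentiable (at x)" for i j
    using u S(2) by (auto simp: numeral_3_eq_3)
  note dp = has_derivative_gradient[OF d(1)] and dv = has_derivative_gradient[OF d(2)]
  have C2: "Ck_on 2 S u" "Ck_on 2 S (?u i)" for i
    using u by (auto simp: numeral_3_eq_3 numeral_2_eq_2
        intro!: continuous_at_imp_continuous_on differentiable_imp_continuous_within)
  define A where "A h = 2 * ((?v 1 2 x * (gradient (?u 2) x \<bullet> h) + (gradient (?v 1 2) x \<bullet> h) * ?u 2 x)
      - (?v 2 2 x * (gradient (?u 1) x \<bullet> h) + (gradient (?v 2 2) x \<bullet> h) * ?u 1 x))" for h
  define B where "B h = 2 * ((?v 1 2 x * (gradient (?u 1) x \<bullet> h) + (gradient (?v 1 2) x \<bullet> h) * ?u 1 x)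
      - (?v 1 1 x * (gradient (?u 2) x \<bullet> h) + (gradient (?v 1 1) x \<bullet> h) * ?u 2 x))" for h
  have eqW: "P_gradient u = (\<lambda>x. (2 * (?v 1 2 x * ?u 2 x - ?v 2 2 x * ?u 1 x)) *\<^sub>R axis 1 1
      + (2 * (?v 1 2 x * ?u 1 x - ?v 1 1 x * ?u 2 x)) *\<^sub>R axis 2 1)"
    by (simp add: fun_eq_iff P_gradient_def vec_eq_iff forall_2 axis_def vector_2)
  have "(P_gradient u has_derivative (\<lambda>h. A h *\<^sub>R axis 1 1 + B h *\<^sub>R axis 2 1)) (at x)"
    unfolding A_def B_def eqW
    by (intro has_derivative_add has_derivative_scaleR_left has_derivative_mult_right
        has_derivative_diff has_derivative_mult dp dv)
  moreover have "(\<Sum>i\<in>Basis. (A i *\<^sub>R axis 1 1 + B i *\<^sub>R axis 2 1) \<bullet> (i :: real^2)) = A (axis 1 1) + B (axis 2 1)"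
    by (simp add: sum_Basis_plane inner_plane axis_def)
  moreover have "A (axis 1 1) + B (axis 2 1) = 4 * ((?v 1 2 x)\<^sup>2 - ?v 1 1 x * ?v 2 2 x)"
  proof -
    have s: "?v 2 1 x = ?v 1 2 x" by (rule partial_deriv_commute[OF S C2(1)])
    have "?w 2 1 1 x = ?w 1 2 1 x" by (rule partial_deriv_commute[OF S C2(2)])
    \<comment> \<open>Second derivatives commute on all of \<open>S\<close>, so they may be
      exchanged under a further derivative.\<close>
    also have "\<dots> = ?w 1 1 2 x"
      by (rule partial_deriv_transform[OF S]) (rule partial_deriv_commute[OF S(1) _ C2(1)])
    finally have 1: "?w 2 1 1 x = ?w 1 1 2 x" .
    have 2: "?w 2 1 2 x = ?w 1 2 2 x" by (rule partial_deriv_commute[OF S C2(2)])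
    show ?thesis unfolding A_def B_def
      by (simp add: inner_plane gradient_def axis_def s 1 2 algebra_simps power2_eq_square)
  qed
  ultimately show ?thesis
    by (intro exI[of _ "\<lambda>h. A h *\<^sub>R axis 1 1 + B h *\<^sub>R axis 2 1"] conjI) (simp_all only:)
qed

text \<open>By Cayley-Hamilton H (H - tr H) = -det H for the 2x2 Hessian; contracting with grad u on
  both sides cancels |grad u|^2 and leaves exactly the divergence of
  \<open>P_gradient\<close>.\<close>

lemma P_drift_gradient:
  assumes "gradient u x \<noteq> 0"
  shows "P_drift u x \<bullet> P_gradient u x = 4 * ((partial_deriv 1 (partial_deriv 2 u) x)\<^sup>2
      - partial_deriv 1 (partial_deriv 1 u) x * partial_deriv 2 (partial_deriv 2 u) x)"
proof -
  define N where "N = gradient u x \<bullet> gradient u x"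
  have N: "N \<noteq> 0" using assms by (simp add: N_def)
  have N2: "N = partial_deriv 1 u x * partial_deriv 1 u x + partial_deriv 2 u x * partial_deriv 2 u x"
    by (simp add: N_def inner_plane gradient_def)
  let ?v = "vector [partial_deriv 1 (partial_deriv 1 u) x * partial_deriv 1 u x
        + partial_deriv 1 (partial_deriv 2 u) x * partial_deriv 2 u x,
     partial_deriv 1 (partial_deriv 2 u) x * partial_deriv 1 u x
        + partial_deriv 2 (partial_deriv 2 u) x * partial_deriv 2 u x] :: real^2"
  have "N * (P_drift u x \<bullet> P_gradient u x) = 2 * (?v \<bullet> P_gradient u x)"
    using N unfolding P_drift_def N_def[symmetric] inner_scaleR_left by simp
  also have "\<dots> = N * (4 * ((partial_deriv 1 (partial_deriv 2 u) x)\<^sup>2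
      - partial_deriv 1 (partial_deriv 1 u) x * partial_deriv 2 (partial_deriv 2 u) x))"
    unfolding P_gradient_def inner_plane vector_2 N2 by (simp add: power2_eq_square algebra_simps)
  finally have "N * (P_drift u x \<bullet> P_gradient u x) = N * (4 * ((partial_deriv 1 (partial_deriv 2 u) x)\<^sup>2
      - partial_deriv 1 (partial_deriv 1 u) x * partial_deriv 2 (partial_deriv 2 u) x))" .
  then show ?thesis using N by simp
qed

section \<open>Strict convexity from local strict convexity\<close>

text \<open>Two uses of \<open>loc\<close>: extremality of the frontier points pushes the open
  segment into the interior of \<open>K\<close>, which gives room around its middle, while convex
  neighbourhoods handle its two ends.\<close>

lemma locally_strictly_convex_component:
  fixes T :: "'a::euclidean_space set"
  assumes T: "closed T" and K: "K \<in> components T"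
    and loc: "\<And>p. p \<in> frontier T \<Longrightarrow> \<exists>r>0. convex (T \<inter> ball p r) \<and>
      (\<forall>x \<in> T \<inter> ball p r. \<forall>y \<in> T \<inter> ball p r. p \<notin> open_segment x y)"
    and xy: "x \<in> K" "y \<in> K"
  shows "open_segment x y \<subseteq> interior K"
proof -
  have KT: "K \<subseteq> T" "connected K" "closed K"
    using K T by (auto simp: in_components_subset in_components_connected closed_components)
  have max: "C \<subseteq> K" if "connected C" "C \<subseteq> T" "p \<in> C" "p \<in> K" for C p
    using components_maximal[OF K that(1,2)] that(3,4) by blast
  have int: "p \<in> interior K" if p: "p \<in> K" "p \<in> interior T" for p
  proof -
    obtain e where "e > 0" "ball p e \<subseteq> T" using p(2) by (auto simp: mem_interior)
    then have "ball p e \<subseteq> K" using max[of "ball p e" p] p(1) by simp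
    then show ?thesis using \<open>e > 0\<close> by (auto simp: mem_interior)
  qed
  have convK: "\<exists>r>0. convex (K \<inter> ball p r)" if p: "p \<in> K" for p
  proof -
    have "\<exists>r>0. convex (T \<inter> ball p r)"
    proof (cases "p \<in> interior T")
      case True
      then obtain e where "e > 0" "ball p e \<subseteq> T" by (auto simp: mem_interior)
      then have "T \<inter> ball p e = ball p e" by blast
      then show ?thesis using \<open>e > 0\<close> by (metis convex_ball)
    next
      case False
      then have "p \<in> frontier T" using p KT closure_subset by (auto simp: frontier_def)
      then show ?thesis using loc by blast
    qed
    then obtain r where r: "r > 0" "convex (T \<inter> ball p r)" by blast
    have "T \<inter> ball p r \<subseteq> K"
      using max[of "T \<inter> ball p r" p] r p KT convex_connected by auto
    then have "K \<inter> ball p r = T \<inter> ball p r" using KT by blast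
    then show ?thesis using r by auto
  qed
  have seg: "open_segment a b \<subseteq> interior K" if ab: "closed_segment a b \<subseteq> K" for a b
  proof
    fix p assume p: "p \<in> open_segment a b"
    then obtain v where v: "a \<noteq> b" "0 < v" "v < 1" "p = (1 - v) *\<^sub>R a + v *\<^sub>R b" by (auto simp: in_segment)
    have pK: "p \<in> K" using p ab open_closed_segment by blast
    show "p \<in> interior K"
    proof (rule ccontr)
      assume "p \<notin> interior K"
      then have "p \<in> frontier T" using int pK KT closure_subset by (auto simp: frontier_def)
      then obtain r where r: "r > 0"
        "\<And>x y. x \<in> T \<inter> ball p r \<Longrightarrow> y \<in> T \<inter> ball p r \<Longrightarrow> p \<notin> open_segment x y"
        using loc by meson
      \<comment> \<open>A short piece of the segment centred at \<open>p\<close>: \<open>s\<close>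
        at most v and 1 - v keeps it between \<open>a\<close> and \<open>b\<close>, the last term
        keeps it in the ball. So \<open>p\<close> would be the midpoint of two nearby points of
        \<open>T\<close>.\<close>
      define s where "s = min (min v (1 - v)) (r / (2 * norm (b - a)))"
      have s: "0 < s" "s \<le> v" "s \<le> 1 - v" "s \<le> r / (2 * norm (b - a))"
        using v r(1) by (auto simp: s_def)
      have "s * (2 * norm (b - a)) \<le> r" using s(4) v(1) by (simp add: pos_le_divide_eq)
      then have sr: "s * norm (b - a) < r" using r(1) by linarith
      define q where "q t = p + t *\<^sub>R (b - a)" for t
      have q: "q t \<in> T \<inter> ball p r" if "\<bar>t\<bar> = s" for t
      proof -
        have "q t = (1 - (v + t)) *\<^sub>R a + (v + t) *\<^sub>R b" by (simp add: q_def v algebra_simps)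
        moreover have "0 \<le> v + t" "v + t \<le> 1" using that s by auto
        ultimately have "q t \<in> closed_segment a b" by (auto simp: in_segment)
        moreover have "dist p (q t) = s * norm (b - a)" using that by (simp add: q_def dist_norm)
        ultimately show ?thesis using ab KT sr by auto
      qed
      have "p = midpoint (q (- s)) (q s)"
        by (simp add: q_def midpoint_def algebra_simps scaleR_2[symmetric])
      moreover have "q s - q (- s) = (2 * s) *\<^sub>R (b - a)" by (simp add: q_def algebra_simps scaleR_2[symmetric])
      then have "q (- s) \<noteq> q s" using s v by auto
      ultimately have "p \<in> open_segment (q (- s)) (q s)" by (simp add: midpoint_in_open_segment)
      then show False using r(2)[OF q q] s(1) by simp
    qed
  qed
  have star: "closed_segment w z \<subseteq> K" if z: "z \<in> K" and w: "w \<in> K" for z w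
  proof -
    \<comment> \<open>Points from which \<open>z\<close> is visible. Closedness is inherited from
      \<open>K\<close>; for openness the segment is cut into a middle part and two ends.\<close>
    define V where "V = {x \<in> K. closed_segment x z \<subseteq> K}"
    have "closedin (top_of_set K) V"
    proof -
      have "V = K \<inter> (\<Inter>t\<in>{0..1}. (\<lambda>x. (1 - t) *\<^sub>R x + t *\<^sub>R z) -` K)"
        by (auto simp: V_def closed_segment_image_interval image_subset_iff)
      moreover have "closed (\<Inter>t\<in>{0..1}. (\<lambda>x. (1 - t) *\<^sub>R x + t *\<^sub>R z) -` K)"
        by (intro closed_INT ballI closed_vimage KT continuous_intros)
      ultimately show ?thesis by (simp add: closedin_closed_Int)
    qed
    moreover have "openin (top_of_set K) V"
      unfolding openin_contains_ball
    proof (intro conjI ballI)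
      show "V \<subseteq> K" by (auto simp: V_def)
      fix x assume "x \<in> V"
      then have x: "x \<in> K" "closed_segment x z \<subseteq> K" by (auto simp: V_def)
      obtain rx where rx: "rx > 0" "convex (K \<inter> ball x rx)" using convK[OF x(1)] by blast
      obtain rz where rz: "rz > 0" "convex (K \<inter> ball z rz)" using convK[OF z] by blast
      show "\<exists>e>0. ball x e \<inter> K \<subseteq> V"
      proof (cases "x = z")
        case True
        have "y \<in> V" if "y \<in> ball x rx \<inter> K" for y
          using closed_segment_subset[OF _ _ rx(2), of y z] that x rx True by (auto simp: V_def)
        then show ?thesis using rx(1) by blast
      next
        case False
        define L where "L = dist x z"
        have L: "L > 0" using False by (simp add: L_def)
        \<comment> \<open>The end pieces have length at most a quarter of the radii of the convex
          neighbourhoods; moving \<open>x\<close> by less than \<open>e\<close> costs at most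
          another quarter.\<close>
        define \<delta> where "\<delta> = min (1/4) (min (rx / (4 * L)) (rz / (4 * L)))"
        have \<delta>: "0 < \<delta>" "\<delta> \<le> 1/4" "\<delta> * L \<le> rx / 4" "\<delta> * L \<le> rz / 4"
        proof -
          show "0 < \<delta>" "\<delta> \<le> 1/4" using L rx rz by (auto simp: \<delta>_def)
          have "\<delta> \<le> rx / (4 * L)" "\<delta> \<le> rz / (4 * L)" by (auto simp: \<delta>_def)
          then show "\<delta> * L \<le> rx / 4" "\<delta> * L \<le> rz / 4" using L by (auto simp: field_simps)
        qed
        define m where "m y t = (1 - t) *\<^sub>R y + t *\<^sub>R z" for y t
        have "compact (m x ` {\<delta>..1-\<delta>})" unfolding m_def
          by (intro compact_continuous_image continuous_intros) simp
        moreover have "m x ` {\<delta>..1-\<delta>} \<subseteq> interior K"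
        proof -
          have "m x t \<in> open_segment x z" if "t \<in> {\<delta>..1-\<delta>}" for t
            using that \<delta> False by (auto simp: m_def in_segment intro!: exI[of _ t])
          then show ?thesis using seg[OF x(2)] by blast
        qed
        \<comment> \<open>The compact middle part lies in the interior of \<open>K\<close> and has a
          tube of radius \<open>\<eta>\<close> there; segments to \<open>z\<close> from points near
          \<open>x\<close> have their middle part in this tube.\<close>
        ultimately obtain \<eta> where \<eta>: "\<eta> > 0" "(\<Union>p\<in>m x ` {\<delta>..1-\<delta>}. ball p \<eta>) \<subseteq> interior K"
          using compact_subset_open_imp_ball_epsilon_subset[of "m x ` {\<delta>..1-\<delta>}" "interior K"] by auto
        define e where "e = min \<eta> (min (rx / 4) (rz / 4))"
        have e: "0 < e" "e \<le> \<eta>" "e \<le> rx / 4" "e \<le> rz / 4" using \<eta> rx rz by (auto simp: e_def)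
        have "y \<in> V" if y: "y \<in> ball x e \<inter> K" for y
        proof -
          have dy: "dist x y < e" and yK: "y \<in> K" using y by auto
          have diff: "dist (m x t) (m y t) \<le> dist x y" if "0 \<le> t" "t \<le> 1" for t
          proof -
            have "m x t - m y t = (1 - t) *\<^sub>R (x - y)" by (simp add: m_def algebra_simps)
            then have "dist (m x t) (m y t) = (1 - t) * dist x y" using that by (simp add: dist_norm)
            also have "\<dots> \<le> 1 * dist x y" using that by (intro mult_right_mono) auto
            finally show ?thesis by simp
          qed
          have mid: "m y t \<in> K" if t: "\<delta> \<le> t" "t \<le> 1 - \<delta>" for t
          proof -
            have "ball (m x t) \<eta> \<subseteq> interior K" using \<eta>(2) t unfolding UN_subset_iff by simp
            moreover have "m y t \<in> ball (m x t) \<eta>" using diff[of t] t \<delta> dy e by simp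
            ultimately have "m y t \<in> interior K" by blast
            then show ?thesis using interior_subset by blast
          qed
          have sub1: "closed_segment y (m y \<delta>) \<subseteq> K"
          proof -
            have "dist x (m x \<delta>) = \<delta> * L"
            proof -
              have "x - m x \<delta> = \<delta> *\<^sub>R (x - z)" by (simp add: m_def algebra_simps)
              then show ?thesis using \<delta> by (simp add: dist_norm L_def)
            qed
            then have "dist x (m y \<delta>) < rx"
              using dist_triangle[of x "m y \<delta>" "m x \<delta>"] diff[of \<delta>] \<delta> dy e by linarith
            then have "m y \<delta> \<in> K \<inter> ball x rx" using mid[of \<delta>] \<delta> by simp
            moreover have "y \<in> K \<inter> ball x rx" using dy yK e rx by simp
            ultimately show ?thesis using closed_segment_subset[OF _ _ rx(2)] by blast
          qed
          have sub2: "closed_segment (m y (1 - \<delta>)) z \<subseteq> K"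
          proof -
            have "m y (1 - \<delta>) - z = \<delta> *\<^sub>R (y - z)" by (simp add: m_def algebra_simps)
            then have "dist (m y (1 - \<delta>)) z = \<delta> * dist y z" using \<delta> by (simp add: dist_norm)
            also have "\<dots> \<le> \<delta> * (dist x y + L)"
              using \<delta> dist_triangle2[of y z x] by (intro mult_left_mono) (auto simp: L_def dist_commute)
            also have "\<dots> \<le> dist x y + \<delta> * L"
              using \<delta> mult_right_mono[of \<delta> 1 "dist x y"] by (simp add: distrib_left)
            also have "\<dots> < rz" using dy e \<delta> rz by linarith
            finally have "m y (1 - \<delta>) \<in> K \<inter> ball z rz" using mid[of "1 - \<delta>"] \<delta> by (simp add: dist_commute)
            moreover have "z \<in> K \<inter> ball z rz" using z rz by simp
            ultimately show ?thesis using closed_segment_subset[OF _ _ rz(2)] by blast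
          qed
          have "m y t \<in> K" if t: "0 \<le> t" "t \<le> 1" for t
          proof -
            consider "t \<le> \<delta>" | "\<delta> \<le> t" "t \<le> 1 - \<delta>" | "1 - \<delta> \<le> t" by linarith
            then show ?thesis
            proof cases
              case 1
              have "m y t = (1 - t/\<delta>) *\<^sub>R y + (t/\<delta>) *\<^sub>R m y \<delta>"
                using \<delta>(1) by (simp add: m_def algebra_simps)
              moreover have "0 \<le> t/\<delta>" "t/\<delta> \<le> 1" using t 1 \<delta>(1) by auto
              ultimately show ?thesis using sub1 by (auto simp: closed_segment_def)
            next
              case 3
              define k where "k = (1 - t)/\<delta>"
              have "m y t = (1 - (1 - k)) *\<^sub>R m y (1 - \<delta>) + (1 - k) *\<^sub>R z"
              proof -
                have "k * \<delta> = 1 - t" using \<delta>(1) by (simp add: k_def)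
                then have t': "t = 1 - k * \<delta>" by simp
                show ?thesis unfolding m_def t' by (simp add: algebra_simps)
              qed
              moreover have "0 \<le> 1 - k" "1 - k \<le> 1" using t 3 \<delta>(1) by (auto simp: k_def)
              ultimately have "m y t \<in> closed_segment (m y (1 - \<delta>)) z"
                unfolding closed_segment_def by blast
              then show ?thesis using sub2 by blast
            qed (rule mid)
          qed
          then show ?thesis using yK by (auto simp: V_def closed_segment_image_interval image_subset_iff m_def)
        qed
        then show ?thesis using e(1) by blast
      qed
    qed
    moreover have "z \<in> V" using z by (simp add: V_def)
    ultimately have "V = K" using KT(2) unfolding connected_clopen by blast
    then show ?thesis using w by (auto simp: V_def)
  qed
  show ?thesis by (rule seg[OF star[OF xy(2,1)]])
qed

section \<open>Convexity near a boundary point in graph coordinates\<close>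

lemma orthonormal_plane_expansion:
  fixes e1 e2 :: "real^2"
  assumes "norm e1 = 1" "norm e2 = 1" "e1 \<bullet> e2 = 0"
  shows "x = (x \<bullet> e1) *\<^sub>R e1 + (x \<bullet> e2) *\<^sub>R e2"
proof -
  define w where "w = x - ((x \<bullet> e1) *\<^sub>R e1 + (x \<bullet> e2) *\<^sub>R e2)"
  define D where "D = e1 $ 1 * e2 $ 2 - e1 $ 2 * e2 $ 1"
  have n: "e1 \<bullet> e1 = 1" "e2 \<bullet> e2 = 1" "e2 \<bullet> e1 = 0" using assms by (auto simp: dot_square_norm inner_commute)
  then have w: "w \<bullet> e1 = 0" "w \<bullet> e2 = 0"
    using assms by (auto simp: w_def inner_diff_left inner_add_left)
  \<comment> \<open>Lagrange's identity: the determinant squares to 1, and Cramer's rule then shows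
    that \<open>w\<close>, orthogonal to both vectors, vanishes.\<close>
  have "D * D = (e1 \<bullet> e1) * (e2 \<bullet> e2) - (e1 \<bullet> e2) * (e1 \<bullet> e2)"
    by (simp add: D_def inner_plane algebra_simps)
  then have D: "D \<noteq> 0" using n assms by auto
  have "D * w $ 1 = e2 $ 2 * (w \<bullet> e1) - e1 $ 2 * (w \<bullet> e2)"
    by (simp add: D_def inner_plane algebra_simps)
  moreover have "D * w $ 2 = e1 $ 1 * (w \<bullet> e2) - e2 $ 1 * (w \<bullet> e1)"
    by (simp add: D_def inner_plane algebra_simps)
  ultimately have "w = 0" using D w by (simp add: vec_eq_iff forall_2)
  then show ?thesis by (simp add: w_def)
qed

text \<open>The complement of the subgraph is locally the epigraph of \<open>\<gamma>\<close>. A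
  second derivative positive at one point stays positive nearby by continuity, so
  \<open>\<gamma>\<close> is convex there, and the tangent line at \<open>p\<close> touches the
  local epigraph at \<open>p\<close> alone, which makes \<open>p\<close> extreme.\<close>

lemma strictly_convex_epigraph_local:
  fixes p e1 e2 :: "real^2"
  assumes e: "norm e1 = 1" "norm e2 = 1" "e1 \<bullet> e2 = 0"
    and \<gamma>: "C2_real \<gamma>" and d: "(deriv \<gamma> has_real_derivative d) (at (p \<bullet> e1))" "0 < d"
    and p: "p \<bullet> e2 = \<gamma> (p \<bullet> e1)"
    and r: "0 < r" "S \<inter> ball p r = {y \<in> ball p r. y \<bullet> e2 < \<gamma> (y \<bullet> e1)}"
  shows "\<exists>r>0. convex (- S \<inter> ball p r) \<and>
      (\<forall>x \<in> - S \<inter> ball p r. \<forall>y \<in> - S \<inter> ball p r. p \<notin> open_segment x y)"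
proof -
  define t0 where "t0 = p \<bullet> e1"
  obtain D where D: "\<And>t. (deriv \<gamma> has_real_derivative D t) (at t)" "continuous_on UNIV D"
    using \<gamma> unfolding C2_real_def C1_differentiable_on_def has_real_derivative_iff_has_vector_derivative
    by auto
  have d\<gamma>: "(\<gamma> has_real_derivative deriv \<gamma> t) (at t)" for t
    using \<gamma> by (simp add: C2_real_def DERIV_deriv_iff_real_differentiable)
  have "D t0 = d" using DERIV_unique[OF D(1)] d(1) by (auto simp: t0_def)
  then have "t0 \<in> D -` {0<..}" using d(2) by simp
  moreover have "open (D -` {0<..})" by (rule open_vimage[OF open_greaterThan D(2)])
  ultimately obtain \<rho> where "\<rho> > 0" "ball t0 \<rho> \<subseteq> D -` {0<..}" unfolding open_contains_ball by blast
  then have \<rho>: "\<rho> > 0" "\<And>t. dist t0 t < \<rho> \<Longrightarrow> D t > 0" by auto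
  define I where "I = {t0 - \<rho><..<t0 + \<rho>}"
  have inc: "deriv \<gamma> s < deriv \<gamma> t" if "s \<in> I" "t \<in> I" "s < t" for s t
    using that \<rho>(2) D(1)
    by (intro DERIV_pos_imp_increasing[OF that(3)]) (auto simp: I_def dist_real_def intro!: exI)
  have conv: "convex_on I \<gamma>"
    by (rule convex_on_realI[where f' = "deriv \<gamma>"]) (use inc d\<gamma> in \<open>auto simp: I_def le_less\<close>)
  have tangent: "\<gamma> t0 + deriv \<gamma> t0 * (t - t0) < \<gamma> t" if t: "t \<in> I" "t \<noteq> t0" for t
  proof (cases "t0 < t")
    case True
    obtain z where z: "t0 < z" "z < t" "\<gamma> t - \<gamma> t0 = (t - t0) * deriv \<gamma> z"
      using MVT2[OF True d\<gamma>] by blast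
    then have "deriv \<gamma> t0 < deriv \<gamma> z" using t by (intro inc) (auto simp: I_def)
    then have "deriv \<gamma> t0 * (t - t0) < deriv \<gamma> z * (t - t0)" using True by simp
    then show ?thesis using z(3) by (simp add: mult.commute)
  next
    case False
    then have "t < t0" using t by simp
    then obtain z where z: "t < z" "z < t0" "\<gamma> t0 - \<gamma> t = (t0 - t) * deriv \<gamma> z"
      using MVT2[OF _ d\<gamma>] by blast
    then have "deriv \<gamma> z < deriv \<gamma> t0" using t by (intro inc) (auto simp: I_def)
    then have "(t0 - t) * deriv \<gamma> z < (t0 - t) * deriv \<gamma> t0" using \<open>t < t0\<close> by simp
    then show ?thesis using z(3) by (simp add: algebra_simps)
  qed
  define r' where "r' = min r \<rho>"
  have r': "r' > 0" "r' \<le> r" using r \<rho> by (auto simp: r'_def)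
  have inI: "y \<bullet> e1 \<in> I" if "y \<in> ball p r'" for y
  proof -
    have "\<bar>(y - p) \<bullet> e1\<bar> \<le> norm (y - p)" using Cauchy_Schwarz_ineq2[of "y - p" e1] e by simp
    also have "\<dots> < \<rho>" using that by (simp add: r'_def dist_norm norm_minus_commute)
    finally show ?thesis by (auto simp: I_def t0_def inner_diff_left)
  qed
  have T: "- S \<inter> ball p r' = {y \<in> ball p r'. \<gamma> (y \<bullet> e1) \<le> y \<bullet> e2}" (is "_ = ?T")
  proof -
    have "y \<in> S \<longleftrightarrow> y \<bullet> e2 < \<gamma> (y \<bullet> e1)" if "y \<in> ball p r'" for y
    proof -
      have "y \<in> ball p r" using that r' by simp
      then show ?thesis using r(2) by blast
    qed
    then show ?thesis by (auto simp: not_less)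
  qed
  have "convex ?T"
  proof (rule convexI)
    fix x y and u v :: real
    assume xy: "x \<in> ?T" "y \<in> ?T" and uv: "0 \<le> u" "0 \<le> v" "u + v = 1"
    have "u *\<^sub>R x + v *\<^sub>R y \<in> ball p r'" using xy uv by (intro convexD[OF convex_ball]) auto
    moreover have "\<gamma> (u * (x \<bullet> e1) + v * (y \<bullet> e1)) \<le> u * \<gamma> (x \<bullet> e1) + v * \<gamma> (y \<bullet> e1)"
    proof -
      have u: "u = 1 - v" using uv by simp
      show ?thesis unfolding u using convex_onD[OF conv, of v "x \<bullet> e1" "y \<bullet> e1"] xy uv inI by auto
    qed
    moreover have "u * \<gamma> (x \<bullet> e1) + v * \<gamma> (y \<bullet> e1) \<le> u * (x \<bullet> e2) + v * (y \<bullet> e2)"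
      using xy uv by (intro add_mono mult_left_mono) auto
    ultimately show "u *\<^sub>R x + v *\<^sub>R y \<in> ?T" by (simp add: inner_add_left)
  qed
  moreover have "p \<notin> open_segment x y" if xy: "x \<in> ?T" "y \<in> ?T" for x y
  proof
    assume p': "p \<in> open_segment x y"
    \<comment> \<open>A multiple of the signed distance to the tangent line at \<open>p\<close>:
      zero at \<open>p\<close>, positive at all other points of the local epigraph, hence positive
      at every convex combination of two of these.\<close>
    define l where "l z = (z - p) \<bullet> (e2 - deriv \<gamma> t0 *\<^sub>R e1)" for z
    have l: "0 < l z" if z: "z \<in> ?T" "z \<noteq> p" for z
    proof -
      have lz: "l z = z \<bullet> e2 - (\<gamma> t0 + deriv \<gamma> t0 * (z \<bullet> e1 - t0))"
        by (simp add: l_def inner_diff p t0_def inner_diff_left inner_diff_right algebra_simps)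
      show ?thesis
      proof (cases "z \<bullet> e1 = t0")
        case True
        have "z \<bullet> e2 \<noteq> p \<bullet> e2"
          using z(2) True orthonormal_plane_expansion[OF e, of z] orthonormal_plane_expansion[OF e, of p]
          by (auto simp: t0_def)
        then show ?thesis using z True lz p by (auto simp: t0_def)
      next
        case False
        then show ?thesis using tangent[of "z \<bullet> e1"] inI[of z] z lz by auto
      qed
    qed
    obtain u where u: "x \<noteq> y" "0 < u" "u < 1" "p = (1 - u) *\<^sub>R x + u *\<^sub>R y"
      using p' by (auto simp: in_segment)
    have "x \<noteq> p" "y \<noteq> p" using p' by (auto simp: open_segment_def)
    then have "0 < l x" "0 < l y" using l xy by blast+
    then have "0 < (1 - u) * l x + u * l y" using u by (intro add_pos_pos mult_pos_pos) auto
    also have "\<dots> = l ((1 - u) *\<^sub>R x + u *\<^sub>R y)"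
      by (simp add: l_def inner_diff_left inner_add_left algebra_simps)
    also have "\<dots> = 0" using u(4) by (simp add: l_def)
    finally show False by simp
  qed
  ultimately show ?thesis unfolding T[symmetric] using r' by blast
qed

section \<open>The boundary curve\<close>

text \<open>Prepares the passage to the limit from inside: a single \<open>\<rho>\<close> serves as
  half-width of the boundary arc and as the depth to which its downward translates stay in
  \<open>S\<close>.\<close>

lemma boundary_curve_frontier:
  assumes g: "local_subgraph S p e1 e2 \<gamma>" and p: "p \<in> frontier S" and S: "open S"
  defines "c \<equiv> \<lambda>t. t *\<^sub>R e1 + \<gamma> t *\<^sub>R e2"
  shows "\<exists>\<rho>>0. \<forall>t. \<bar>t - p \<bullet> e1\<bar> < \<rho> \<longrightarrow> c t \<in> frontier S \<and> (\<forall>s. 0 < s \<and> s < \<rho> \<longrightarrow> c t - s *\<^sub>R e2 \<in> S)"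
proof -
  from g obtain r where r: "r > 0" "S \<inter> ball p r = {y \<in> ball p r. y \<bullet> e2 < \<gamma> (y \<bullet> e1)}"
    and \<gamma>: "\<And>t. \<gamma> differentiable (at t)" and e: "norm e1 = 1" "norm e2 = 1" "e1 \<bullet> e2 = 0"
    unfolding local_subgraph_def C2_real_def by blast
  have n: "e1 \<bullet> e1 = 1" "e2 \<bullet> e2 = 1" "e2 \<bullet> e1 = 0" using e by (auto simp: dot_square_norm inner_commute)
  define t0 where "t0 = p \<bullet> e1"
  have cp: "c t0 = p"
    using orthonormal_plane_expansion[OF e, of p] local_subgraph_boundary[OF g p] by (simp add: c_def t0_def)
  have c\<gamma>: "isCont \<gamma> t" for t using \<gamma> differentiable_imp_continuous_within by blast
  have cc: "isCont c t" for t unfolding c_def by (intro continuous_intros c\<gamma>)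
  obtain \<delta> where \<delta>: "\<delta> > 0" "\<And>t. dist t t0 < \<delta> \<Longrightarrow> dist (c t) p < r / 2"
    using cc[of t0] r(1) unfolding continuous_at_eps_delta cp[symmetric] by (metis half_gt_zero)
  define \<rho> where "\<rho> = min \<delta> (r / 2)"
  have \<rho>: "\<rho> > 0" "\<rho> \<le> \<delta>" "\<rho> \<le> r / 2" using \<delta> r by (auto simp: \<rho>_def)
  have inb: "c t - s *\<^sub>R e2 \<in> ball p r" if "\<bar>t - t0\<bar> < \<rho>" "0 \<le> s" "s < \<rho>" for s t
  proof -
    have "dist p (c t - s *\<^sub>R e2) \<le> dist p (c t) + dist (c t) (c t - s *\<^sub>R e2)" by (rule dist_triangle)
    also have "\<dots> = dist (c t) p + s" using e that by (simp add: dist_norm norm_minus_commute)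
    also have "\<dots> < r" using \<delta>(2)[of t] that \<rho> by (simp add: dist_real_def)
    finally show ?thesis by simp
  qed
  have co: "(c t - s *\<^sub>R e2) \<bullet> e1 = t" "(c t - s *\<^sub>R e2) \<bullet> e2 = \<gamma> t - s" for s t
    using n e by (auto simp: c_def inner_diff_left inner_add_left)
  have iff: "y \<in> S \<longleftrightarrow> y \<bullet> e2 < \<gamma> (y \<bullet> e1)" if "y \<in> ball p r" for y
    using r(2) that by blast
  have inS: "c t - s *\<^sub>R e2 \<in> S" if "\<bar>t - t0\<bar> < \<rho>" "0 < s" "s < \<rho>" for s t
    using iff[OF inb] that co by simp
  moreover have "c t \<in> frontier S" if t: "\<bar>t - t0\<bar> < \<rho>" for t
  proof -
    have "c t \<notin> S" using iff[OF inb[OF t, of 0]] co[of t 0] \<rho> by simp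
    moreover have "c t \<in> closure S"
    proof -
      have "((\<lambda>s. c t - s *\<^sub>R e2) \<longlongrightarrow> c t - 0 *\<^sub>R e2) (at_right 0)" by (intro tendsto_intros)
      then have "((\<lambda>s. c t - s *\<^sub>R e2) \<longlongrightarrow> c t) (at_right 0)" by simp
      moreover have "\<forall>\<^sub>F s in at_right 0. c t - s *\<^sub>R e2 \<in> closure S"
        using inS[OF t] \<rho>(1) closure_subset unfolding eventually_at_right_field
        by (intro exI[of _ \<rho>]) auto
      ultimately show ?thesis by (intro Lim_in_closed_set[of "closure S"]) auto
    qed
    ultimately show ?thesis using S by (simp add: frontier_def interior_open)
  qed
  ultimately show ?thesis using \<rho>(1) unfolding t0_def by blast
qed

text \<open>A function that is \<open>C\<^sup>1\<close> up to the boundary need not extend across it, so the chain rule along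
  the boundary curve is obtained from the curves \<open>c t - s e2\<close> inside \<open>S\<close> as \<open>s \<rightarrow> 0\<close>.\<close>

lemma boundary_curve_derivative:
  assumes g: "local_subgraph S p e1 e2 \<gamma>"
    and \<rho>: "\<And>t. \<bar>t - p \<bullet> e1\<bar> < \<rho> \<Longrightarrow> t *\<^sub>R e1 + \<gamma> t *\<^sub>R e2 \<in> frontier S"
      "\<And>t s. \<bar>t - p \<bullet> e1\<bar> < \<rho> \<Longrightarrow> 0 < s \<Longrightarrow> s < \<rho> \<Longrightarrow> t *\<^sub>R e1 + \<gamma> t *\<^sub>R e2 - s *\<^sub>R e2 \<in> S"
    and \<phi>: "continuous_on (closure S) \<phi>" and \<Phi>: "continuous_on (closure S) \<Phi>"
    and d: "\<And>x. x \<in> S \<Longrightarrow> (\<phi> has_derivative (\<lambda>h. \<Phi> x \<bullet> h)) (at x)"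
    and t1: "\<bar>t1 - p \<bullet> e1\<bar> < \<rho>"
  shows "((\<lambda>t. \<phi> (t *\<^sub>R e1 + \<gamma> t *\<^sub>R e2)) has_real_derivative
    \<Phi> (t1 *\<^sub>R e1 + \<gamma> t1 *\<^sub>R e2) \<bullet> (e1 + deriv \<gamma> t1 *\<^sub>R e2)) (at t1)"
proof -
  define c where "c t = t *\<^sub>R e1 + \<gamma> t *\<^sub>R e2" for t
  define c' where "c' t = e1 + deriv \<gamma> t *\<^sub>R e2" for t
  define t0 where "t0 = p \<bullet> e1"
  define A where "A = \<Phi> (c t1) \<bullet> c' t1"
  \<comment> \<open>Parameters of arc and depth, with depth 0 included: the candidate derivative
    along the translated curves is continuous on this box, hence uniformly close to \<open>A\<close>
    near \<open>(t1, 0)\<close>.\<close>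
  define Bx where "Bx = {t. \<bar>t - t0\<bar> < \<rho>} \<times> {0..<\<rho>}"
  have \<gamma>: "\<gamma> differentiable (at t)" for t
    using g by (auto simp: local_subgraph_def C2_real_def)
  have "deriv \<gamma> C1_differentiable_on UNIV"
    using g by (auto simp: local_subgraph_def C2_real_def)
  then have cg': "continuous_on UNIV (deriv \<gamma>)" using C1_differentiable_imp_continuous_on by blast
  have d\<gamma>: "(\<gamma> has_real_derivative deriv \<gamma> t) (at t)" for t
    using \<gamma> by (simp add: DERIV_deriv_iff_real_differentiable)
  have cg: "continuous_on UNIV \<gamma>"
    using \<gamma> by (simp add: continuous_on_eq_continuous_at differentiable_imp_continuous_within)
  have cl: "c t - s *\<^sub>R e2 \<in> closure S" if "\<bar>t - t0\<bar> < \<rho>" "0 \<le> s" "s < \<rho>" for s t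
  proof (cases "s = 0")
    case True
    then show ?thesis using \<rho>(1)[of t] that by (auto simp: c_def t0_def frontier_def)
  next
    case False
    then show ?thesis using \<rho>(2)[of t s] that closure_subset by (auto simp: c_def t0_def)
  qed
  have contc: "continuous_on Bx (\<lambda>z. c (fst z) - snd z *\<^sub>R e2)"
    unfolding c_def by (intro continuous_intros continuous_on_compose2[OF cg]) auto
  have "continuous_on Bx (\<lambda>z. \<Phi> (c (fst z) - snd z *\<^sub>R e2) \<bullet> c' (fst z))"
    unfolding c'_def
    by (intro continuous_intros continuous_on_compose2[OF cg'] continuous_on_compose2[OF \<Phi> contc])
      (auto simp: Bx_def intro!: cl)
  moreover have in1: "(t1, 0) \<in> Bx" using t1 by (auto simp: Bx_def t0_def)
  ultimately have Q: "\<exists>\<delta>>0. \<forall>z\<in>Bx. dist z (t1, 0) < \<delta> \<longrightarrow>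
      dist (\<Phi> (c (fst z) - snd z *\<^sub>R e2) \<bullet> c' (fst z)) A < \<epsilon>" if "\<epsilon> > 0" for \<epsilon>
    using that unfolding continuous_on_iff by (force simp: A_def)
  have "((\<lambda>t. \<phi> (c t)) has_derivative (\<lambda>h. A * h)) (at t1)"
    unfolding has_derivative_at_alt
  proof (intro conjI allI impI bounded_linear_mult_right)
    fix \<epsilon> :: real assume \<epsilon>: "\<epsilon> > 0"
    obtain \<delta> where \<delta>: "\<delta> > 0" "\<And>z. z \<in> Bx \<Longrightarrow> dist z (t1, 0) < \<delta> \<Longrightarrow>
      dist (\<Phi> (c (fst z) - snd z *\<^sub>R e2) \<bullet> c' (fst z)) A < \<epsilon>" using Q[OF \<epsilon>] by blast
    define \<eta> where "\<eta> = min (\<delta> / 2) (\<rho> - \<bar>t1 - t0\<bar>)"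
    have \<eta>: "0 < \<eta>" "\<eta> \<le> \<delta> / 2" "\<eta> \<le> \<rho> - \<bar>t1 - t0\<bar>" using \<delta>(1) t1 unfolding \<eta>_def t0_def by linarith+
    have key: "norm (\<phi> (c y) - \<phi> (c t1) - A * (y - t1)) \<le> \<epsilon> * norm (y - t1)" if y: "norm (y - t1) < \<eta>" for y
    proof -
      have box: "\<bar>t - t0\<bar> < \<rho>" if "t \<in> ball t1 \<eta>" for t
        using that \<eta>(3) by (auto simp: dist_real_def)
      have s: "norm (\<phi> (c y - s *\<^sub>R e2) - \<phi> (c t1 - s *\<^sub>R e2) - A * (y - t1)) \<le> \<epsilon> * norm (y - t1)"
        if s: "0 < s" "s < \<eta>" for s
      proof -
        \<comment> \<open>Subtracting the linear part leaves a function with derivative at most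
          \<open>\<epsilon>\<close> in absolute value; the mean value bound is independent of the
          depth \<open>s\<close> and so survives the limit s -> 0.\<close>
        define k where "k t = \<phi> (c t - s *\<^sub>R e2) - A * t" for t
        have s\<rho>: "s < \<rho>" using s \<eta> by linarith
        have dk: "(k has_derivative (\<lambda>h. (\<Phi> (c t - s *\<^sub>R e2) \<bullet> c' t - A) * h)) (at t)" if t: "t \<in> ball t1 \<eta>" for t
        proof -
          have inS: "c t - s *\<^sub>R e2 \<in> S" using \<rho>(2)[of t s] box[OF t] s s\<rho> by (simp add: c_def t0_def)
          have "(\<gamma> has_derivative (\<lambda>h. h * deriv \<gamma> t)) (at t)"
            using d\<gamma>[of t] unfolding has_field_derivative_def by (simp add: mult.commute[of _ "deriv \<gamma> t"])
          then have "((\<lambda>t. c t - s *\<^sub>R e2) has_derivative (\<lambda>h. h *\<^sub>R e1 + (h * deriv \<gamma> t) *\<^sub>R e2 - 0)) (at t)"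
            unfolding c_def
            by (intro has_derivative_diff has_derivative_add has_derivative_scaleR_left has_derivative_ident
                has_derivative_const)
          then have "((\<lambda>t. c t - s *\<^sub>R e2) has_derivative (\<lambda>h. h *\<^sub>R c' t)) (at t)"
            by (simp add: c'_def scaleR_add_right)
          from has_derivative_compose[OF this d[OF inS]]
          have "((\<lambda>t. \<phi> (c t - s *\<^sub>R e2)) has_derivative (\<lambda>h. \<Phi> (c t - s *\<^sub>R e2) \<bullet> (h *\<^sub>R c' t))) (at t)" .
          then have "(k has_derivative (\<lambda>h. \<Phi> (c t - s *\<^sub>R e2) \<bullet> (h *\<^sub>R c' t) - A * h)) (at t)"
            unfolding k_def by (intro has_derivative_diff has_derivative_mult_right has_derivative_ident)
          moreover have "(\<lambda>h. \<Phi> (c t - s *\<^sub>R e2) \<bullet> (h *\<^sub>R c' t) - A * h) = (\<lambda>h. (\<Phi> (c t - s *\<^sub>R e2) \<bullet> c' t - A) * h)"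
            by (simp add: fun_eq_iff left_diff_distrib)
          ultimately show ?thesis by (simp only:)
        qed
        have "norm (k y - k t1) \<le> \<epsilon> * norm (y - t1)"
        proof (rule differentiable_bound[of "ball t1 \<eta>" k])
          show "(k has_derivative (\<lambda>h. (\<Phi> (c t - s *\<^sub>R e2) \<bullet> c' t - A) * h)) (at t within ball t1 \<eta>)"
            if "t \<in> ball t1 \<eta>" for t using dk[OF that] has_derivative_at_withinI by blast
          show "onorm (\<lambda>h. (\<Phi> (c t - s *\<^sub>R e2) \<bullet> c' t - A) * h) \<le> \<epsilon>" if t: "t \<in> ball t1 \<eta>" for t
          proof (rule onorm_le)
            fix h :: real
            have "(t, s) \<in> Bx" using box[OF t] s s\<rho> by (simp add: Bx_def)
            moreover have "dist (t, s) (t1, 0) < \<delta>"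
            proof -
              have "dist (t, s) (t1, 0) \<le> dist t t1 + dist s 0"
                using sqrt_sum_squares_le_sum_abs[of "dist t t1" s] by (simp add: dist_Pair_Pair)
              also have "\<dots> < \<delta>" using t s \<eta> by (simp add: dist_real_def)
              finally show ?thesis .
            qed
            ultimately have "\<bar>\<Phi> (c t - s *\<^sub>R e2) \<bullet> c' t - A\<bar> \<le> \<epsilon>"
              using \<delta>(2)[of "(t, s)"] by (simp add: dist_real_def)
            then show "norm ((\<Phi> (c t - s *\<^sub>R e2) \<bullet> c' t - A) * h) \<le> \<epsilon> * norm h"
              by (simp add: abs_mult mult_right_mono)
          qed
        qed (use y \<eta> in \<open>auto simp: dist_real_def abs_minus_commute\<close>)
        then show ?thesis by (simp add: k_def algebra_simps)
      qed
      have lim: "((\<lambda>s. \<phi> (c t - s *\<^sub>R e2)) \<longlongrightarrow> \<phi> (c t)) (at_right 0)" if t: "t \<in> ball t1 \<eta>" for t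
      proof -
        have \<rho>0: "0 < \<rho>" using t1 by simp
        have "((\<lambda>s. c t - s *\<^sub>R e2) \<longlongrightarrow> c t - 0 *\<^sub>R e2) (at_right 0)" by (intro tendsto_intros)
        then have "((\<lambda>s. c t - s *\<^sub>R e2) \<longlongrightarrow> c t) (at_right 0)" by simp
        then show ?thesis
          using cl[OF box[OF t]] cl[OF box[OF t], of 0] \<rho>0
          by (intro continuous_on_tendsto_compose[OF \<phi>])
            (auto simp: eventually_at_right_field intro!: exI[of _ \<rho>])
      qed
      have "((\<lambda>s. norm (\<phi> (c y - s *\<^sub>R e2) - \<phi> (c t1 - s *\<^sub>R e2) - A * (y - t1)))
          \<longlongrightarrow> norm (\<phi> (c y) - \<phi> (c t1) - A * (y - t1))) (at_right 0)"
        using y \<eta> by (intro tendsto_intros lim) (auto simp: dist_real_def)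
      then show ?thesis
        by (rule tendsto_upperbound) (use s \<eta>(1) in \<open>auto simp: eventually_at_right_field intro!: exI[of _ \<eta>]\<close>)
    qed
    then show "\<exists>\<eta>>0. \<forall>y. norm (y - t1) < \<eta> \<longrightarrow> norm (\<phi> (c y) - \<phi> (c t1) - A * (y - t1)) \<le> \<epsilon> * norm (y - t1)"
      using \<eta>(1) by blast
  qed
  then show ?thesis unfolding has_field_derivative_def c_def A_def c'_def by simp
qed

text \<open>Interior sphere condition, required by Hopf's lemma. Differentiability of the slope at
  the base point keeps \<open>\<gamma>\<close> above its tangent minus a parabola, and a small
  enough ball tangent at \<open>p\<close> fits below, locally.\<close>

lemma interior_ball_at_boundary:
  assumes g: "local_subgraph S p e1 e2 \<gamma>" and p: "p \<in> frontier S"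
  defines "\<nu> \<equiv> sgn (e2 - deriv \<gamma> (p \<bullet> e1) *\<^sub>R e1)"
  shows "\<exists>R>0. \<exists>\<rho>>0. \<forall>y \<in> cball (p - R *\<^sub>R \<nu>) R \<inter> cball p \<rho>. y \<noteq> p \<longrightarrow> y \<in> S"
proof -
  from g obtain r where r: "r > 0" "S \<inter> ball p r = {y \<in> ball p r. y \<bullet> e2 < \<gamma> (y \<bullet> e1)}"
    and \<gamma>: "C2_real \<gamma>" and e: "norm e1 = 1" "norm e2 = 1" "e1 \<bullet> e2 = 0"
    unfolding local_subgraph_def by blast
  define t0 where "t0 = p \<bullet> e1"
  define n where "n = e2 - deriv \<gamma> t0 *\<^sub>R e1"
  have "n \<bullet> e2 = 1" using e by (simp add: n_def inner_diff_left dot_square_norm)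
  then have N: "1 \<le> norm n" using Cauchy_Schwarz_ineq2[of n e2] e by simp
  then have "n \<noteq> 0" by auto
  moreover have "\<nu> = sgn n" by (simp add: \<nu>_def n_def t0_def)
  ultimately have \<nu>: "norm n *\<^sub>R \<nu> = n" by (simp add: sgn_div_norm)
  have n\<nu>: "\<nu> \<bullet> \<nu> = 1"
  proof -
    have "n \<noteq> 0" using N by auto
    then have "norm \<nu> = 1" by (simp add: \<nu>_def n_def t0_def norm_sgn)
    then show ?thesis by (simp add: dot_square_norm)
  qed
  obtain D where D: "(deriv \<gamma> has_real_derivative D) (at t0)"
    using \<gamma> unfolding C2_real_def C1_differentiable_on_def has_real_derivative_iff_has_vector_derivative
    by auto
  have d\<gamma>: "(\<gamma> has_real_derivative deriv \<gamma> t) (at t)" for t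
    using \<gamma> by (simp add: C2_real_def DERIV_deriv_iff_real_differentiable)
  \<comment> \<open>The added 1 absorbs the error in the first-order expansion of
    \<open>deriv \<gamma>\<close> at \<open>t0\<close>, taken with accuracy 1, and makes
    \<open>C\<close> positive.\<close>
  define C where "C = \<bar>D\<bar> + 1"
  obtain \<delta> where \<delta>: "\<delta> > 0" "\<And>t. \<bar>t - t0\<bar> < \<delta> \<Longrightarrow> \<bar>deriv \<gamma> t - deriv \<gamma> t0 - D * (t - t0)\<bar> \<le> \<bar>t - t0\<bar>"
    using D unfolding has_field_derivative_def has_derivative_at_alt
    by (metis mult_1 real_norm_def zero_less_one)
  have lip: "\<bar>deriv \<gamma> t - deriv \<gamma> t0\<bar> \<le> C * \<bar>t - t0\<bar>" if "\<bar>t - t0\<bar> < \<delta>" for t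
  proof -
    have "\<bar>deriv \<gamma> t - deriv \<gamma> t0\<bar> \<le> \<bar>deriv \<gamma> t - deriv \<gamma> t0 - D * (t - t0)\<bar> + \<bar>D * (t - t0)\<bar>" by linarith
    also have "\<dots> \<le> \<bar>t - t0\<bar> + \<bar>D\<bar> * \<bar>t - t0\<bar>" using \<delta>(2)[OF that] by (simp add: abs_mult)
    finally show ?thesis by (simp add: C_def algebra_simps)
  qed
  have taylor: "\<gamma> t0 + deriv \<gamma> t0 * (t - t0) - C * (t - t0)\<^sup>2 \<le> \<gamma> t" if t: "\<bar>t - t0\<bar> < \<delta>" for t
  proof -
    have "\<exists>z. \<bar>z - t0\<bar> \<le> \<bar>t - t0\<bar> \<and> \<gamma> t - \<gamma> t0 = (t - t0) * deriv \<gamma> z"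
    proof (cases t t0 rule: linorder_cases)
      case less
      then obtain z where "t < z" "z < t0" "\<gamma> t0 - \<gamma> t = (t0 - t) * deriv \<gamma> z"
        using MVT2[OF _ d\<gamma>] by blast
      then show ?thesis by (intro exI[of _ z]) (auto simp: algebra_simps)
    next
      case greater
      then obtain z where "t0 < z" "z < t" "\<gamma> t - \<gamma> t0 = (t - t0) * deriv \<gamma> z"
        using MVT2[OF _ d\<gamma>] by blast
      then show ?thesis by (intro exI[of _ z]) auto
    qed auto
    then obtain z where z: "\<bar>z - t0\<bar> \<le> \<bar>t - t0\<bar>" "\<gamma> t - \<gamma> t0 = (t - t0) * deriv \<gamma> z" by blast
    have "\<bar>(t - t0) * (deriv \<gamma> z - deriv \<gamma> t0)\<bar> \<le> \<bar>t - t0\<bar> * (C * \<bar>t - t0\<bar>)"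
    proof -
      have "\<bar>deriv \<gamma> z - deriv \<gamma> t0\<bar> \<le> C * \<bar>z - t0\<bar>" using lip z t by simp
      also have "\<dots> \<le> C * \<bar>t - t0\<bar>" using z by (simp add: C_def mult_left_mono)
      finally show ?thesis by (simp add: abs_mult mult_left_mono)
    qed
    then have "- (C * (t - t0)\<^sup>2) \<le> (t - t0) * (deriv \<gamma> z - deriv \<gamma> t0)"
      by (simp add: power2_eq_square abs_le_iff algebra_simps)
    then show ?thesis using z(2) by (simp add: algebra_simps)
  qed
  \<comment> \<open>Gives 2 R C = 1/2: the circle is curved more than the parabola.\<close>
  define R where "R = 1 / (4 * C)"
  have C: "C > 0" by (simp add: C_def)
  then have R: "R > 0" "2 * R * C < 1" by (auto simp: R_def)
  define \<rho> where "\<rho> = min r \<delta> / 2"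
  have \<rho>: "\<rho> > 0" "\<rho> < r" "\<rho> < \<delta>" using r(1) \<delta>(1) by (auto simp: \<rho>_def min_def)
  have "y \<in> S" if y: "y \<in> cball (p - R *\<^sub>R \<nu>) R" "y \<in> cball p \<rho>" "y \<noteq> p" for y
  proof -
    define h where "h = y - p"
    define H where "H = h \<bullet> h"
    have H: "H > 0" using y by (simp add: H_def h_def)
    have "norm (h + R *\<^sub>R \<nu>) \<le> R"
      using y(1) by (simp add: h_def dist_norm norm_minus_commute algebra_simps)
    then have "(h + R *\<^sub>R \<nu>) \<bullet> (h + R *\<^sub>R \<nu>) \<le> R\<^sup>2"
      using R by (simp add: dot_square_norm power_mono)
    \<comment> \<open>Membership in the tangent ball, expanded: |h|^2 <= -2 R (h . \<nu>). With |n|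
      >= 1 this pushes \<open>h \<bullet> n\<close> below -C |h|^2, beyond the quadratic error of
      \<open>\<gamma>\<close>.\<close>
    then have "H + 2 * R * (h \<bullet> \<nu>) \<le> 0"
      using n\<nu> by (simp add: H_def inner_add_left inner_add_right inner_commute power2_eq_square)
    then have "norm n * (H + 2 * R * (h \<bullet> \<nu>)) \<le> 0" using N by (intro mult_nonneg_nonpos) auto
    moreover have hn: "h \<bullet> n = norm n * (h \<bullet> \<nu>)" by (metis \<nu> inner_scaleR_right)
    ultimately have "norm n * H + 2 * R * (h \<bullet> n) \<le> 0" unfolding hn by (simp add: algebra_simps)
    moreover have "H \<le> norm n * H" using N H by simp
    ultimately have "H + 2 * R * (h \<bullet> n) \<le> 0" by linarith
    moreover have "2 * R * (C * H) < H"
      using mult_strict_right_mono[OF R(2) H] by (simp add: mult.assoc)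
    ultimately have "2 * R * (C * H) < 2 * R * (- (h \<bullet> n))" unfolding mult_minus_right by linarith
    moreover have "0 < 2 * R" using R(1) by simp
    ultimately have "C * H < - (h \<bullet> n)" using mult_less_cancel_left_pos by blast
    then have hn: "h \<bullet> n < - C * H" by linarith
    have dt: "y \<bullet> e1 - t0 = h \<bullet> e1" by (simp add: h_def t0_def inner_diff_left)
    have he: "\<bar>h \<bullet> e1\<bar> \<le> norm h" using Cauchy_Schwarz_ineq2[of h e1] e by simp
    have nh: "norm h \<le> \<rho>" using y(2) by (simp add: h_def dist_norm norm_minus_commute)
    have "(h \<bullet> e1)\<^sup>2 \<le> H" using power_mono[OF he, of 2] by (simp add: H_def dot_square_norm)
    then have "C * (h \<bullet> e1)\<^sup>2 \<le> C * H" using C by simp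
    moreover have "y \<bullet> e2 = p \<bullet> e2 + h \<bullet> n + deriv \<gamma> t0 * (h \<bullet> e1)"
      by (simp add: h_def n_def inner_diff_left inner_diff_right)
    moreover have "\<gamma> t0 + deriv \<gamma> t0 * (h \<bullet> e1) - C * (h \<bullet> e1)\<^sup>2 \<le> \<gamma> (y \<bullet> e1)"
      using taylor[of "y \<bullet> e1"] dt he nh \<rho> by simp
    moreover have "p \<bullet> e2 = \<gamma> t0" using local_subgraph_boundary[OF g p] by (simp add: t0_def)
    ultimately have "y \<bullet> e2 < \<gamma> (y \<bullet> e1)" using hn by linarith
    moreover have "y \<in> ball p r" using y(2) \<rho> by simp
    ultimately show ?thesis using r(2) by blast
  qed
  then show ?thesis using R(1) \<rho>(1) by blast
qed

section \<open>Strict curvature of the boundary\<close>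

text \<open>Planar form of the problem, \<open>S\<close> being the preimage of the domain. Values of
  \<open>partial_deriv\<close> on the boundary carry no information, so \<open>g\<close>,
  \<open>h11\<close>, \<open>h12\<close>, \<open>h22\<close> stand for the continuous extensions of
  gradient and Hessian to the closure.\<close>

locale overdetermined_solution =
  fixes S :: "(real^2) set" and u :: "real^2 \<Rightarrow> real" and f F :: "real \<Rightarrow> real" and \<alpha> :: real
    and g :: "real^2 \<Rightarrow> real^2" and h11 h12 h22 :: "real^2 \<Rightarrow> real"
  assumes open_S: "open S" and C2_S: "C2_boundary S"
    and C3: "Ck_on 3 S u"
    and eq: "x \<in> S \<Longrightarrow> laplacian u x + f (u x) = 0"
    and F: "(F has_real_derivative f t) (at t)" and F0: "F 0 = 0"
    and u_cont: "continuous_on (closure S) u" and u_frontier: "x \<in> frontier S \<Longrightarrow> u x = 0"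
    and g_cont: "continuous_on (closure S) g" and g_eq: "x \<in> S \<Longrightarrow> g x = gradient u x"
    and h_cont: "continuous_on (closure S) h11" "continuous_on (closure S) h12" "continuous_on (closure S) h22"
    and h_eq: "x \<in> S \<Longrightarrow> h11 x = partial_deriv 1 (partial_deriv 1 u) x"
      "x \<in> S \<Longrightarrow> h12 x = partial_deriv 1 (partial_deriv 2 u) x"
      "x \<in> S \<Longrightarrow> h22 x = partial_deriv 2 (partial_deriv 2 u) x"
    and neumann: "outward_unit_normal S x \<nu> \<Longrightarrow> g x \<bullet> \<nu> = \<alpha>"
    and \<alpha>: "\<alpha> < 0"
begin

definition P :: "real^2 \<Rightarrow> real" where "P x = g x \<bullet> g x + 2 * F (u x)"

lemma C2: "Ck_on 2 S u"
  using C3 by (auto simp: numeral_3_eq_3 numeral_2_eq_2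
      intro!: continuous_at_imp_continuous_on differentiable_imp_continuous_within)

lemma P_continuous: "continuous_on (closure S) P"
proof -
  have "continuous_on UNIV F"
    using F by (meson DERIV_isCont continuous_at_imp_continuous_on)
  then show ?thesis unfolding P_def
    by (intro continuous_intros g_cont continuous_on_compose2[OF _ u_cont, of UNIV F]) auto
qed

lemma has_derivative_transform_S:
  assumes "x \<in> S" "(\<phi> has_derivative D) (at x)" "\<And>y. y \<in> S \<Longrightarrow> \<psi> y = \<phi> y"
  shows "(\<psi> has_derivative D) (at x)"
  using has_derivative_transform_within_open[OF assms(2) open_S assms(1)] assms(3) by metis

lemma P_has_derivative:
  assumes "x \<in> S" shows "(P has_derivative (\<lambda>k. P_gradient u x \<bullet> k)) (at x)"
  by (rule has_derivative_transform_S[OF assms P_function_has_derivative[OF open_S assms C2 F eq[OF assms]]])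
    (simp add: P_def P_function_def g_eq)

lemma P_gradient_differential:
  assumes "x \<in> S"
  shows "(P_gradient u has_derivative frechet_derivative (P_gradient u) (at x)) (at x)"
  using P_gradient_divergence[OF open_S assms C3] differentiableI frechet_derivative_works by blast

text \<open>In fact equality holds; what matters is a drift bounded up to the boundary, where Hopf's
  lemma is applied. Written with \<open>g\<close> and the extended second derivatives, the drift is
  continuous on the closure where \<open>g\<close> does not vanish, hence bounded near
  \<open>x\<close>.\<close>

lemma P_differential_inequality:
  assumes x: "x \<in> closure S" "g x \<noteq> 0"
  shows "\<exists>r>0. \<exists>b \<beta>. \<forall>y \<in> ball x r \<inter> S. norm (b y) \<le> \<beta> \<and>
    b y \<bullet> P_gradient u y \<le> (\<Sum>i\<in>Basis. frechet_derivative (P_gradient u) (at y) i \<bullet> i)"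
proof -
  define A where "A = {y \<in> closure S. g y \<noteq> 0}"
  define b where "b y = (2 / (g y \<bullet> g y)) *\<^sub>R ((h11 y * g y $ 1 + h12 y * g y $ 2) *\<^sub>R axis 1 1
      + (h12 y * g y $ 1 + h22 y * g y $ 2) *\<^sub>R (axis 2 1 :: real^2))" for y
  have cA: "continuous_on A g" "continuous_on A h11" "continuous_on A h12" "continuous_on A h22"
    using continuous_on_subset[OF g_cont] continuous_on_subset[OF h_cont(1)]
      continuous_on_subset[OF h_cont(2)] continuous_on_subset[OF h_cont(3)] by (auto simp: A_def)
  have "continuous_on A b" unfolding b_def
    by (intro continuous_intros cA) (auto simp: A_def)
  moreover have "x \<in> A" using x by (simp add: A_def)
  ultimately obtain r1 where r1: "r1 > 0" "\<And>y. y \<in> A \<Longrightarrow> dist y x < r1 \<Longrightarrow> dist (b y) (b x) < 1"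
    unfolding continuous_on_iff by (metis zero_less_one)
  obtain r2 where r2: "r2 > 0" "\<And>y. y \<in> closure S \<Longrightarrow> dist y x < r2 \<Longrightarrow> dist (g y) (g x) < norm (g x)"
    using g_cont x unfolding continuous_on_iff by (metis zero_less_norm_iff)
  have "norm (b y) \<le> norm (b x) + 1 \<and>
      b y \<bullet> P_gradient u y \<le> (\<Sum>i\<in>Basis. frechet_derivative (P_gradient u) (at y) i \<bullet> i)"
    if y: "y \<in> ball x (min r1 r2) \<inter> S" for y
  proof -
    have yS: "y \<in> S" "y \<in> closure S" using y closure_subset by auto
    have "dist (g y) (g x) < norm (g x)" using r2(2)[OF yS(2)] y by (simp add: dist_commute)
    then have gy: "g y \<noteq> 0" by auto
    then have "dist (b y) (b x) < 1" using r1(2)[of y] yS y by (simp add: A_def dist_commute)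
    then have "norm (b y) \<le> norm (b x) + 1"
      using norm_triangle_sub[of "b y" "b x"] by (simp add: dist_norm)
    moreover have "b y = P_drift u y"
      using yS(1) by (simp add: b_def P_drift_def g_eq[symmetric] h_eq vec_eq_iff forall_2 axis_def vector_2)
        (simp add: g_eq gradient_def)
    moreover have "gradient u y \<noteq> 0" using gy g_eq yS by simp
    moreover obtain W' where W': "(P_gradient u has_derivative W') (at y)"
      "(\<Sum>i\<in>Basis. W' i \<bullet> i) = 4 * ((partial_deriv 1 (partial_deriv 2 u) y)\<^sup>2
        - partial_deriv 1 (partial_deriv 1 u) y * partial_deriv 2 (partial_deriv 2 u) y)"
      using P_gradient_divergence[OF open_S yS(1) C3] by blast
    ultimately show ?thesis
      using P_drift_gradient[of u y] frechet_derivative_at[OF W'(1)] by simp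
  qed
  moreover have "min r1 r2 > 0" using r1 r2 by simp
  ultimately show ?thesis by blast
qed

lemma P_max_set_open:
  assumes "\<And>x. x \<in> S \<Longrightarrow> P x \<le> M" "\<And>x. x \<in> S \<Longrightarrow> P x = M \<Longrightarrow> g x \<noteq> 0"
  shows "open {x \<in> S. P x = M}"
  by (rule strong_maximum_principle[OF open_S assms(1) P_has_derivative P_gradient_differential])
    (use P_differential_inequality assms(2) closure_subset in blast)+

text \<open>The Dirichlet condition differentiated along the boundary. It is given on a whole arc
  because it is differentiated once more to reach the curvature.\<close>

lemma gradient_tangential:
  assumes "local_subgraph S p e1 e2 \<gamma>" "p \<in> frontier S"
  shows "\<exists>\<rho>>0. \<forall>t. \<bar>t - p \<bullet> e1\<bar> < \<rho> \<longrightarrow>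
    g (t *\<^sub>R e1 + \<gamma> t *\<^sub>R e2) \<bullet> (e1 + deriv \<gamma> t *\<^sub>R e2) = 0"
proof -
  obtain \<rho> where \<rho>: "\<rho> > 0" "\<And>t. \<bar>t - p \<bullet> e1\<bar> < \<rho> \<Longrightarrow> t *\<^sub>R e1 + \<gamma> t *\<^sub>R e2 \<in> frontier S"
      "\<And>t s. \<bar>t - p \<bullet> e1\<bar> < \<rho> \<Longrightarrow> 0 < s \<Longrightarrow> s < \<rho> \<Longrightarrow> t *\<^sub>R e1 + \<gamma> t *\<^sub>R e2 - s *\<^sub>R e2 \<in> S"
    using boundary_curve_frontier[OF assms open_S] by blast
  have "g (t1 *\<^sub>R e1 + \<gamma> t1 *\<^sub>R e2) \<bullet> (e1 + deriv \<gamma> t1 *\<^sub>R e2) = 0" if t1: "\<bar>t1 - p \<bullet> e1\<bar> < \<rho>" for t1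
  proof -
    have du: "(u has_derivative (\<lambda>k. g x \<bullet> k)) (at x)" if "x \<in> S" for x
      using has_derivative_gradient[of u x] C2 that by (simp add: g_eq numeral_2_eq_2)
    have "((\<lambda>t. u (t *\<^sub>R e1 + \<gamma> t *\<^sub>R e2)) has_real_derivative
        g (t1 *\<^sub>R e1 + \<gamma> t1 *\<^sub>R e2) \<bullet> (e1 + deriv \<gamma> t1 *\<^sub>R e2)) (at t1)"
      by (rule boundary_curve_derivative[OF assms(1) \<rho>(2,3) u_cont g_cont du t1])
    moreover have "((\<lambda>t. u (t *\<^sub>R e1 + \<gamma> t *\<^sub>R e2)) has_real_derivative 0) (at t1)"
    proof (rule has_field_derivative_transform_within[of "\<lambda>_. 0" _ _ UNIV "\<rho> - \<bar>t1 - p \<bullet> e1\<bar>"])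
      show "0 < \<rho> - \<bar>t1 - p \<bullet> e1\<bar>" using t1 by simp
      fix t assume "dist t t1 < \<rho> - \<bar>t1 - p \<bullet> e1\<bar>"
      then have "\<bar>t - p \<bullet> e1\<bar> < \<rho>" by (simp add: dist_real_def)
      then show "0 = u (t *\<^sub>R e1 + \<gamma> t *\<^sub>R e2)" using \<rho>(2) u_frontier by simp
    qed auto
    ultimately show ?thesis by (rule DERIV_unique)
  qed
  then show ?thesis using \<rho>(1) by blast
qed

lemma gradient_normal:
  assumes l: "local_subgraph S p e1 e2 \<gamma>" and p: "p \<in> frontier S"
  shows "g p = \<alpha> *\<^sub>R sgn (e2 - deriv \<gamma> (p \<bullet> e1) *\<^sub>R e1)"
proof -
  let ?n = "e2 - deriv \<gamma> (p \<bullet> e1) *\<^sub>R e1" and ?c = "e1 + deriv \<gamma> (p \<bullet> e1) *\<^sub>R e2"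
  have e: "norm e1 = 1" "norm e2 = 1" "e1 \<bullet> e2 = 0" using l by (auto simp: local_subgraph_def)
  have n: "e1 \<bullet> e1 = 1" "e2 \<bullet> e2 = 1" "e2 \<bullet> e1 = 0" using e by (auto simp: dot_square_norm inner_commute)
  have "?n \<bullet> e2 = 1" "?c \<bullet> e1 = 1" using n e by (auto simp: inner_diff_left inner_add_left)
  then have nz: "?n \<noteq> 0" "?c \<noteq> 0" by auto
  have ort: "sgn ?c \<bullet> sgn ?n = 0"
    using n e by (simp add: sgn_div_norm inner_diff_right inner_add_left)
  have p_eq: "(p \<bullet> e1) *\<^sub>R e1 + \<gamma> (p \<bullet> e1) *\<^sub>R e2 = p"
    using orthonormal_plane_expansion[OF e, of p] local_subgraph_boundary[OF l p] by simp
  have "g ((p \<bullet> e1) *\<^sub>R e1 + \<gamma> (p \<bullet> e1) *\<^sub>R e2) \<bullet> ?c = 0"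
    using gradient_tangential[OF l p] by auto
  then have "g p \<bullet> ?c = 0" unfolding p_eq .
  then have "g p \<bullet> sgn ?c = 0" by (simp add: sgn_div_norm)
  moreover have "g p \<bullet> sgn ?n = \<alpha>"
    using neumann[of p] l p unfolding outward_unit_normal_def by blast
  moreover have "g p = (g p \<bullet> sgn ?c) *\<^sub>R sgn ?c + (g p \<bullet> sgn ?n) *\<^sub>R sgn ?n"
    using nz ort by (intro orthonormal_plane_expansion) (auto simp: norm_sgn)
  ultimately show ?thesis by simp
qed

lemma P_frontier:
  assumes "p \<in> frontier S" shows "P p = \<alpha>\<^sup>2" "g p \<noteq> 0"
proof -
  obtain e1 e2 \<gamma> where l: "local_subgraph S p e1 e2 \<gamma>" using C2_S assms by (auto simp: C2_boundary_def)
  then have "outward_unit_normal S p (sgn (e2 - deriv \<gamma> (p \<bullet> e1) *\<^sub>R e1))"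
    using assms unfolding outward_unit_normal_def by blast
  then have "norm (sgn (e2 - deriv \<gamma> (p \<bullet> e1) *\<^sub>R e1)) = 1" by (rule outward_unit_normal_sides(1))
  then have n: "norm (g p) = \<bar>\<alpha>\<bar>" by (simp add: gradient_normal[OF l assms])
  then show "P p = \<alpha>\<^sup>2" by (simp add: P_def u_frontier[OF assms] F0 dot_square_norm)
  show "g p \<noteq> 0" using n \<alpha> by auto
qed

text \<open>Multiplied by \<open>-2\<alpha> > 0\<close>, the quantity below is the normal derivative of the P-function, which is
  positive by Hopf's lemma.\<close>

lemma tangential_hessian_pos:
  assumes l: "local_subgraph S p e1 e2 \<gamma>" and p: "p \<in> frontier S"
    and P: "\<And>x. x \<in> S \<Longrightarrow> P x < \<alpha>\<^sup>2"
  defines "\<nu> \<equiv> sgn (e2 - deriv \<gamma> (p \<bullet> e1) *\<^sub>R e1)"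
  shows "0 < h11 p * (\<nu> $ 2)\<^sup>2 - 2 * h12 p * \<nu> $ 1 * \<nu> $ 2 + h22 p * (\<nu> $ 1)\<^sup>2"
proof -
  have out: "outward_unit_normal S p \<nu>"
    using l p unfolding outward_unit_normal_def \<nu>_def by blast
  then have n1: "norm \<nu> = 1" by (rule outward_unit_normal_sides(1))
  obtain R \<rho>1 where R: "R > 0" "\<rho>1 > 0"
    "\<And>y. y \<in> cball (p - R *\<^sub>R \<nu>) R \<inter> cball p \<rho>1 \<Longrightarrow> y \<noteq> p \<Longrightarrow> y \<in> S"
    using interior_ball_at_boundary[OF l p] unfolding \<nu>_def by blast
  have pc: "p \<in> closure S" using p by (simp add: frontier_def)
  obtain r b \<beta> where r: "r > 0" "\<And>y. y \<in> ball p r \<inter> S \<Longrightarrow> norm (b y) \<le> \<beta> \<and>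
    b y \<bullet> P_gradient u y \<le> (\<Sum>i\<in>Basis. frechet_derivative (P_gradient u) (at y) i \<bullet> i)"
    using P_differential_inequality[OF pc P_frontier(2)[OF p]] by blast
  define \<rho> where "\<rho> = min (min \<rho>1 (R/2)) (r/2)"
  have \<rho>: "0 < \<rho>" "\<rho> \<le> \<rho>1" "\<rho> < R" "\<rho> < r" using R r by (auto simp: \<rho>_def)
  let ?c = "p - R *\<^sub>R \<nu>"
  have inS: "y \<in> S" if "y \<in> cball ?c R \<inter> cball p \<rho>" "y \<noteq> p" for y
    using R(3)[of y] that \<rho> by auto
  have inS': "y \<in> S \<and> y \<in> ball p r \<inter> S" if "y \<in> ball ?c R \<inter> ball p \<rho>" for y
  proof -
    have "y \<noteq> p" using that R(1) n1 by (auto simp: dist_norm)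
    then show ?thesis using inS[of y] that \<rho> by auto
  qed
  have "\<exists>k>0. \<forall>t\<in>{0..\<rho>}. P (p - t *\<^sub>R ((p - ?c) /\<^sub>R R)) \<le> P p - k * t"
  proof (rule hopf_boundary_point[where W = "P_gradient u" and b = b and \<beta> = \<beta>
        and W' = "\<lambda>y. frechet_derivative (P_gradient u) (at y)"])
    show "continuous_on (cball ?c R \<inter> cball p \<rho>) P"
      using P_continuous by (rule continuous_on_subset) (use inS pc closure_subset in blast)
    show "P x < P p" if "x \<in> cball ?c R \<inter> cball p \<rho>" "x \<noteq> p" for x
      using P inS[OF that] P_frontier[OF p] by simp
    show "dist p ?c = R" using n1 R by (simp add: dist_norm)
  qed (use \<rho> inS' r(2) P_has_derivative P_gradient_differential in blast)+
  then obtain k where k: "k > 0" "\<And>t. t \<in> {0..\<rho>} \<Longrightarrow> P (p - t *\<^sub>R \<nu>) \<le> P p - k * t"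
    using R by auto
  obtain d where d: "d > 0" "\<And>t. 0 < t \<Longrightarrow> t < d \<Longrightarrow> p + t *\<^sub>R (- \<nu>) \<in> S"
    using outward_unit_normal_sides(2)[OF out, of "- \<nu>"] n1 by (auto simp: dot_square_norm)
  \<comment> \<open>Continuous extension of \<open>P_gradient\<close> to the closure, which gives
    its boundary values a meaning.\<close>
  define W where "W x = (2 * (h12 x * g x $ 2 - h22 x * g x $ 1)) *\<^sub>R axis 1 1
     + (2 * (h12 x * g x $ 1 - h11 x * g x $ 2)) *\<^sub>R (axis 2 1 :: real^2)" for x
  have Wc: "continuous_on (closure S) W"
    unfolding W_def by (intro continuous_intros g_cont h_cont)
  have WS: "P_gradient u x = W x" if "x \<in> S" for x
    using that by (simp add: W_def P_gradient_def h_eq vec_eq_iff forall_2 axis_def vector_2 g_eq gradient_def)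
  \<comment> \<open>\<open>P\<close> need not be differentiable at \<open>p\<close>; were the limit
    slope below \<open>k\<close>, the mean value theorem on a short inner normal segment would
    contradict the decay from Hopf's lemma.\<close>
  have "k \<le> W p \<bullet> \<nu>"
  proof (rule ccontr)
    assume "\<not> k \<le> W p \<bullet> \<nu>"
    then have pos: "0 < k - W p \<bullet> \<nu>" by simp
    have "continuous_on (closure S) (\<lambda>x. W x \<bullet> \<nu>)" by (intro continuous_intros Wc)
    then obtain \<eta> where \<eta>: "\<eta> > 0"
      "\<And>x. x \<in> closure S \<Longrightarrow> dist x p < \<eta> \<Longrightarrow> dist (W x \<bullet> \<nu>) (W p \<bullet> \<nu>) < k - W p \<bullet> \<nu>"
      using pc pos unfolding continuous_on_iff by metis
    define t where "t = min (\<eta> / 2) (min (d / 2) \<rho>)"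
    have t: "0 < t" "t < \<eta>" "t < d" "t \<le> \<rho>" using \<eta> d \<rho> by (auto simp: t_def)
    have q: "p - s *\<^sub>R \<nu> \<in> S" if "0 < s" "s \<le> t" for s using d(2)[of s] that t by simp
    have qc: "p - s *\<^sub>R \<nu> \<in> closure S" if "0 \<le> s" "s \<le> t" for s
      using q[of s] that pc closure_subset by (cases "s = 0") auto
    have "\<exists>z. 0 < z \<and> z < t \<and> P (p - t *\<^sub>R \<nu>) - P (p - 0 *\<^sub>R \<nu>) = (P_gradient u (p - z *\<^sub>R \<nu>) \<bullet> (- \<nu>)) * (t - 0)"
    proof -
      have cont: "continuous_on {0..t} (\<lambda>s. P (p - s *\<^sub>R \<nu>))"
        by (intro continuous_on_compose2[OF P_continuous] continuous_intros) (auto intro: qc)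
      have der: "((\<lambda>s. P (p - s *\<^sub>R \<nu>)) has_derivative (\<lambda>k. (P_gradient u (p - z *\<^sub>R \<nu>) \<bullet> (- \<nu>)) * k)) (at z)"
        if "0 < z" "z < t" for z
      proof -
        have "((\<lambda>s. p - s *\<^sub>R \<nu>) has_derivative (\<lambda>k. 0 - k *\<^sub>R \<nu>)) (at z)"
          by (intro has_derivative_diff has_derivative_const has_derivative_scaleR_left has_derivative_ident)
        moreover have "p - z *\<^sub>R \<nu> \<in> S" using q that by simp
        ultimately have "((\<lambda>s. P (p - s *\<^sub>R \<nu>)) has_derivative (\<lambda>k. P_gradient u (p - z *\<^sub>R \<nu>) \<bullet> (0 - k *\<^sub>R \<nu>))) (at z)"
          using has_derivative_compose[OF _ P_has_derivative] by blast
        moreover have "(\<lambda>k. P_gradient u (p - z *\<^sub>R \<nu>) \<bullet> (0 - k *\<^sub>R \<nu>))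
            = (\<lambda>k. (P_gradient u (p - z *\<^sub>R \<nu>) \<bullet> (- \<nu>)) * k)" by (simp add: fun_eq_iff)
        ultimately show ?thesis by (simp only:)
      qed
      show ?thesis by (rule mvt[OF t(1) cont der]) blast+
    qed
    then obtain z where z: "0 < z" "z < t"
      "P (p - t *\<^sub>R \<nu>) - P p = - (W (p - z *\<^sub>R \<nu>) \<bullet> \<nu>) * t"
      using WS q by auto
    have "P (p - t *\<^sub>R \<nu>) - P p \<le> - k * t" using k(2)[of t] t by simp
    then have "k * t \<le> (W (p - z *\<^sub>R \<nu>) \<bullet> \<nu>) * t" using z(3) by simp
    then have "k \<le> W (p - z *\<^sub>R \<nu>) \<bullet> \<nu>" using t(1) by simp
    moreover have "dist (W (p - z *\<^sub>R \<nu>) \<bullet> \<nu>) (W p \<bullet> \<nu>) < k - W p \<bullet> \<nu>"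
      by (rule \<eta>(2)) (use qc[of z] z t n1 in \<open>auto simp: dist_norm\<close>)
    ultimately show False by (simp add: dist_real_def)
  qed
  \<comment> \<open>With grad u = \<alpha> \<nu> at the boundary, the cofactor form turns the normal
    derivative of \<open>P\<close> into the Hessian evaluated on the tangent direction.\<close>
  moreover have "W p \<bullet> \<nu> = (- 2 * \<alpha>) * (h11 p * (\<nu> $ 2)\<^sup>2 - 2 * h12 p * \<nu> $ 1 * \<nu> $ 2 + h22 p * (\<nu> $ 1)\<^sup>2)"
  proof -
    have "g p = \<alpha> *\<^sub>R \<nu>" using gradient_normal[OF l p] by (simp add: \<nu>_def)
    then show ?thesis by (simp add: W_def inner_plane axis_def power2_eq_square algebra_simps)
  qed
  ultimately have "0 < (- 2 * \<alpha>) * (h11 p * (\<nu> $ 2)\<^sup>2 - 2 * h12 p * \<nu> $ 1 * \<nu> $ 2 + h22 p * (\<nu> $ 1)\<^sup>2)"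
    using k(1) by linarith
  moreover have "0 < - 2 * \<alpha>" using \<alpha> by simp
  ultimately show ?thesis by (rule zero_less_mult_pos)
qed

text \<open>Differentiating the tangential identity along the boundary arc gives H(c', c') + D (e2 .
  grad u) = 0, with \<open>D\<close> the second derivative of \<open>\<gamma>\<close>. The first
  term is positive by Hopf's lemma and the factor of \<open>D\<close> is negative as \<alpha> < 0,
  so \<open>D\<close> is positive.\<close>

lemma boundary_strictly_curved:
  assumes l: "local_subgraph S p e1 e2 \<gamma>" and p: "p \<in> frontier S"
    and P: "\<And>x. x \<in> S \<Longrightarrow> P x < \<alpha>\<^sup>2"
  shows "\<exists>d>0. (deriv \<gamma> has_real_derivative d) (at (p \<bullet> e1))"
proof -
  define t0 where "t0 = p \<bullet> e1"
  define n where "n = e2 - deriv \<gamma> t0 *\<^sub>R e1"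
  define \<nu> where "\<nu> = sgn n"
  define c where "c t = t *\<^sub>R e1 + \<gamma> t *\<^sub>R e2" for t
  define c' where "c' t = e1 + deriv \<gamma> t *\<^sub>R e2" for t
  have e: "norm e1 = 1" "norm e2 = 1" "e1 \<bullet> e2 = 0" using l by (auto simp: local_subgraph_def)
  have ee: "e1 \<bullet> e1 = 1" "e2 \<bullet> e2 = 1" "e2 \<bullet> e1 = 0" using e by (auto simp: dot_square_norm inner_commute)
  have ne: "n \<bullet> e2 = 1" "c' t0 \<bullet> e1 = 1" "c' t0 \<bullet> n = 0" using ee e
    by (auto simp: n_def c'_def inner_diff_left inner_add_left inner_diff_right)
  then have n0: "n \<noteq> 0" by auto
  have cp: "c t0 = p"
    using orthonormal_plane_expansion[OF e, of p] local_subgraph_boundary[OF l p] by (simp add: c_def t0_def)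
  obtain D where D: "(deriv \<gamma> has_real_derivative D) (at t0)"
    using l unfolding local_subgraph_def C2_real_def C1_differentiable_on_def
      has_real_derivative_iff_has_vector_derivative by auto
  obtain \<rho>1 where \<rho>1: "\<rho>1 > 0" "\<And>t. \<bar>t - t0\<bar> < \<rho>1 \<Longrightarrow> c t \<in> frontier S"
      "\<And>t s. \<bar>t - t0\<bar> < \<rho>1 \<Longrightarrow> 0 < s \<Longrightarrow> s < \<rho>1 \<Longrightarrow> c t - s *\<^sub>R e2 \<in> S"
    using boundary_curve_frontier[OF l p open_S] unfolding c_def t0_def by blast
  obtain \<rho>2 where \<rho>2: "\<rho>2 > 0" "\<And>t. \<bar>t - t0\<bar> < \<rho>2 \<Longrightarrow> g (c t) \<bullet> c' t = 0"
    using gradient_tangential[OF l p] unfolding c_def c'_def t0_def by blast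
  have t0: "\<bar>t0 - p \<bullet> e1\<bar> < \<rho>1" using \<rho>1 by (simp add: t0_def)
  note bc = boundary_curve_derivative[OF l \<rho>1(2,3)[unfolded c_def t0_def] _ _ _ t0, folded c_def c'_def]
  have G1: "((\<lambda>t. g (c t) $ 1) has_real_derivative (h11 p *\<^sub>R axis 1 1 + h12 p *\<^sub>R axis 2 1) \<bullet> c' t0) (at t0)"
    unfolding cp[symmetric]
  proof (rule bc[of "\<lambda>x. g x $ 1" "\<lambda>x. h11 x *\<^sub>R axis 1 1 + h12 x *\<^sub>R axis 2 1"])
    show "((\<lambda>x. g x $ 1) has_derivative (\<lambda>k. (h11 x *\<^sub>R axis 1 1 + h12 x *\<^sub>R axis 2 1) \<bullet> k)) (at x)" if "x \<in> S" for x
    proof (rule has_derivative_transform_S[OF that])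
      have "partial_deriv 1 u differentiable (at x)" using C2 that by (auto simp: numeral_2_eq_2)
      from has_derivative_gradient[OF this]
      have "(partial_deriv 1 u has_derivative (\<lambda>k. gradient (partial_deriv 1 u) x \<bullet> k)) (at x)" .
      moreover have "gradient (partial_deriv 1 u) x = h11 x *\<^sub>R axis 1 1 + h12 x *\<^sub>R axis 2 1"
        using partial_deriv_commute[OF open_S that C2, of 1 2] that
        by (simp add: vec_eq_iff forall_2 axis_def gradient_def h_eq)
      ultimately show "(partial_deriv 1 u has_derivative (\<lambda>k. (h11 x *\<^sub>R axis 1 1 + h12 x *\<^sub>R axis 2 1) \<bullet> k)) (at x)"
        by (simp only:)
    qed (simp add: g_eq gradient_def)
  qed (auto intro!: continuous_intros g_cont h_cont)
  have G2: "((\<lambda>t. g (c t) $ 2) has_real_derivative (h12 p *\<^sub>R axis 1 1 + h22 p *\<^sub>R axis 2 1) \<bullet> c' t0) (at t0)"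
    unfolding cp[symmetric]
  proof (rule bc[of "\<lambda>x. g x $ 2" "\<lambda>x. h12 x *\<^sub>R axis 1 1 + h22 x *\<^sub>R axis 2 1"])
    show "((\<lambda>x. g x $ 2) has_derivative (\<lambda>k. (h12 x *\<^sub>R axis 1 1 + h22 x *\<^sub>R axis 2 1) \<bullet> k)) (at x)" if "x \<in> S" for x
    proof (rule has_derivative_transform_S[OF that])
      have "partial_deriv 2 u differentiable (at x)" using C2 that by (auto simp: numeral_2_eq_2)
      from has_derivative_gradient[OF this]
      have "(partial_deriv 2 u has_derivative (\<lambda>k. gradient (partial_deriv 2 u) x \<bullet> k)) (at x)" .
      moreover have "gradient (partial_deriv 2 u) x = h12 x *\<^sub>R axis 1 1 + h22 x *\<^sub>R axis 2 1"
        using that by (simp add: vec_eq_iff forall_2 axis_def gradient_def h_eq)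
      ultimately show "(partial_deriv 2 u has_derivative (\<lambda>k. (h12 x *\<^sub>R axis 1 1 + h22 x *\<^sub>R axis 2 1) \<bullet> k)) (at x)"
        by (simp only:)
    qed (simp add: g_eq gradient_def)
  qed (auto intro!: continuous_intros g_cont h_cont)
  have C': "((\<lambda>t. c' t $ i) has_real_derivative D * e2 $ i) (at t0)" for i
    unfolding c'_def using D by (auto intro!: derivative_eq_intros)
  let ?Q = "((h11 p *\<^sub>R axis 1 1 + h12 p *\<^sub>R axis 2 1) \<bullet> c' t0) * c' t0 $ 1
      + ((h12 p *\<^sub>R axis 1 1 + h22 p *\<^sub>R axis 2 1) \<bullet> c' t0) * c' t0 $ 2"
  have "((\<lambda>t. g (c t) $ 1 * c' t $ 1 + g (c t) $ 2 * c' t $ 2) has_real_derivative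
      (((h11 p *\<^sub>R axis 1 1 + h12 p *\<^sub>R axis 2 1) \<bullet> c' t0) * c' t0 $ 1 + (D * e2 $ 1) * g (c t0) $ 1)
      + (((h12 p *\<^sub>R axis 1 1 + h22 p *\<^sub>R axis 2 1) \<bullet> c' t0) * c' t0 $ 2 + (D * e2 $ 2) * g (c t0) $ 2)) (at t0)"
    by (intro DERIV_add DERIV_mult G1 G2 C')
  moreover have "((\<lambda>t. g (c t) $ 1 * c' t $ 1 + g (c t) $ 2 * c' t $ 2) has_real_derivative 0) (at t0)"
  proof (rule has_field_derivative_transform_within[of "\<lambda>_. 0" _ _ UNIV \<rho>2])
    show "0 = g (c t) $ 1 * c' t $ 1 + g (c t) $ 2 * c' t $ 2" if "dist t t0 < \<rho>2" for t
      using \<rho>2(2)[of t] that by (simp add: inner_plane dist_real_def)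
  qed (use \<rho>2 in auto)
  ultimately have "(((h11 p *\<^sub>R axis 1 1 + h12 p *\<^sub>R axis 2 1) \<bullet> c' t0) * c' t0 $ 1 + (D * e2 $ 1) * g (c t0) $ 1)
      + (((h12 p *\<^sub>R axis 1 1 + h22 p *\<^sub>R axis 2 1) \<bullet> c' t0) * c' t0 $ 2 + (D * e2 $ 2) * g (c t0) $ 2) = 0"
    by (rule DERIV_unique)
  then have eq1: "?Q + D * (e2 \<bullet> g p) = 0" by (simp add: cp inner_plane algebra_simps)
  have gp: "g p = \<alpha> *\<^sub>R \<nu>" using gradient_normal[OF l p] by (simp add: \<nu>_def n_def t0_def)
  have "e2 \<bullet> g p = \<alpha> / norm n"
    using ne by (simp add: gp \<nu>_def sgn_div_norm inner_commute divide_inverse)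
  then have neg: "e2 \<bullet> g p < 0" using \<alpha> n0 by (simp add: divide_neg_pos)
  \<comment> \<open>\<open>\<nu>\<close> rotated by a right angle; the tangent vector
    \<open>c' t0\<close> is a multiple of it, which identifies \<open>?Q\<close> with the quadratic
    form of \<open>tangential_hessian_pos\<close> up to a square factor.\<close>
  define \<tau> where "\<tau> = (- \<nu> $ 2) *\<^sub>R axis 1 1 + \<nu> $ 1 *\<^sub>R (axis 2 1 :: real^2)"
  have \<nu>1: "norm \<nu> = 1" using n0 by (simp add: \<nu>_def norm_sgn)
  have \<tau>1: "norm \<tau> = 1" "\<nu> \<bullet> \<tau> = 0"
  proof -
    have "\<tau> \<bullet> \<tau> = \<nu> \<bullet> \<nu>" by (simp add: \<tau>_def inner_plane axis_def)
    then show "norm \<tau> = 1" using \<nu>1 by (simp add: norm_eq_sqrt_inner)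
    show "\<nu> \<bullet> \<tau> = 0" by (simp add: \<tau>_def inner_plane axis_def)
  qed
  define \<mu> where "\<mu> = c' t0 \<bullet> \<tau>"
  have "c' t0 \<bullet> \<nu> = 0" using ne by (simp add: \<nu>_def sgn_div_norm)
  then have c\<tau>: "c' t0 = \<mu> *\<^sub>R \<tau>"
    using orthonormal_plane_expansion[OF \<nu>1 \<tau>1, of "c' t0"] by (simp add: \<mu>_def)
  have "\<mu> \<noteq> 0" using ne(2) c\<tau> by auto
  have "?Q = \<mu>\<^sup>2 * (h11 p * (\<nu> $ 2)\<^sup>2 - 2 * h12 p * \<nu> $ 1 * \<nu> $ 2 + h22 p * (\<nu> $ 1)\<^sup>2)"
    unfolding c\<tau> by (simp add: \<tau>_def inner_plane axis_def power2_eq_square algebra_simps)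
  moreover have "0 < \<mu>\<^sup>2 * (h11 p * (\<nu> $ 2)\<^sup>2 - 2 * h12 p * \<nu> $ 1 * \<nu> $ 2 + h22 p * (\<nu> $ 1)\<^sup>2)"
    using tangential_hessian_pos[OF l p P] \<open>\<mu> \<noteq> 0\<close> by (simp add: \<nu>_def n_def t0_def)
  ultimately have "D * (e2 \<bullet> g p) < 0" using eq1 by linarith
  then have "0 < D" using neg by (simp add: mult_less_0_iff)
  then show ?thesis using D by (auto simp: t0_def)
qed

lemma complement_component_strictly_convex:
  assumes P: "\<And>x. x \<in> S \<Longrightarrow> P x < \<alpha>\<^sup>2" and K: "K \<in> components (- S)"
  shows "strictly_convex K"
proof -
  have "\<exists>r>0. convex (- S \<inter> ball p r) \<and>
      (\<forall>x \<in> - S \<inter> ball p r. \<forall>y \<in> - S \<inter> ball p r. p \<notin> open_segment x y)"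
    if p: "p \<in> frontier (- S)" for p
  proof -
    have p': "p \<in> frontier S" using p by (simp add: frontier_complement)
    then obtain e1 e2 \<gamma> where l: "local_subgraph S p e1 e2 \<gamma>" using C2_S by (auto simp: C2_boundary_def)
    obtain d where d: "(deriv \<gamma> has_real_derivative d) (at (p \<bullet> e1))" "0 < d"
      using boundary_strictly_curved[OF l p' P] by blast
    obtain r where r: "0 < r" "S \<inter> ball p r = {y \<in> ball p r. y \<bullet> e2 < \<gamma> (y \<bullet> e1)}"
      using l unfolding local_subgraph_def by blast
    have e: "norm e1 = 1" "norm e2 = 1" "e1 \<bullet> e2 = 0" "C2_real \<gamma>" using l by (auto simp: local_subgraph_def)
    show ?thesis
      by (rule strictly_convex_epigraph_local[OF e d local_subgraph_boundary[OF l p'] r])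
  qed
  then have "open_segment x y \<subseteq> interior K" if "x \<in> K" "y \<in> K" for x y
    using locally_strictly_convex_component[of "- S" K x y] open_S K that by (simp add: closed_Compl)
  then show ?thesis by (simp add: strictly_convex_def)
qed

end

section \<open>The flat torus\<close>

text \<open>\<open>S\<close> is unbounded, so maxima are sought in a compact \<open>Q\<close>
  meeting every lattice orbit of \<open>S\<close>; periodicity makes them maxima over
  \<open>S\<close>. The premise \<open>conn\<close> is connectedness of the domain on the torus,
  expressed upstairs for lattice-invariant sets.\<close>

lemma (in overdetermined_solution) P_less_boundary_value:
  assumes L: "\<And>x l. l \<in> L \<Longrightarrow> x \<in> S \<Longrightarrow> x + l \<in> S" "\<And>x l. l \<in> L \<Longrightarrow> u (x + l) = u x"
    and Q: "compact Q" "\<And>x. x \<in> S \<Longrightarrow> \<exists>l\<in>L. x + l \<in> Q"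
    and conn: "\<And>E. open E \<Longrightarrow> open (S - E) \<Longrightarrow> E \<subseteq> S \<Longrightarrow>
      (\<And>x l. l \<in> L \<Longrightarrow> x \<in> E \<Longrightarrow> x + l \<in> E) \<Longrightarrow> E = {} \<or> E = S"
    and pos: "\<And>x. x \<in> S \<Longrightarrow> 0 < u x"
    and F_less: "\<And>x. x \<in> S \<Longrightarrow> 2 * F (u x) < \<alpha>\<^sup>2"
    and ne: "S \<noteq> {}" "frontier S \<noteq> {}"
    and x: "x \<in> S"
  shows "P x < \<alpha>\<^sup>2"
proof -
  have Pper: "P (x + l) = P x" if "l \<in> L" "x \<in> S" for x l
  proof -
    have "u (x + l + t *\<^sub>R axis i 1) = u (x + t *\<^sub>R axis i 1)" for t i
      using L(2)[OF that(1), of "x + t *\<^sub>R axis i 1"] by (simp add: algebra_simps)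
    then have "gradient u (x + l) = gradient u x" by (simp add: gradient_def partial_deriv_def)
    then show ?thesis using that L by (simp add: P_def g_eq)
  qed
  let ?A = "closure S \<inter> Q"
  have "compact ?A" using Q(1) by (simp add: closed_Int_compact)
  have AS: "\<exists>l\<in>L. x + l \<in> ?A \<inter> S" if "x \<in> S" for x
    using Q(2)[OF that] L(1) that closure_subset by blast
  then have "?A \<noteq> {}" using ne by blast
  obtain m where m: "m \<in> ?A" "\<And>y. y \<in> ?A \<Longrightarrow> P y \<le> P m"
    using continuous_attains_sup[OF \<open>compact ?A\<close> \<open>?A \<noteq> {}\<close>, of P] P_continuous continuous_on_subset by blast
  obtain z where z: "z \<in> ?A" "\<And>y. y \<in> ?A \<Longrightarrow> u y \<le> u z"
    using continuous_attains_sup[OF \<open>compact ?A\<close> \<open>?A \<noteq> {}\<close>, of u] u_cont continuous_on_subset by blast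
  have PM: "P y \<le> P m" if y: "y \<in> S" for y
  proof -
    obtain l where l: "l \<in> L" "y + l \<in> ?A" using AS[OF y] by blast
    then show ?thesis using m(2)[of "y + l"] Pper[OF l(1) y] by simp
  qed
  have uM: "u y \<le> u z" if y: "y \<in> S" for y
  proof -
    obtain l where l: "l \<in> L" "y + l \<in> ?A" using AS[OF y] by blast
    then show ?thesis using z(2)[of "y + l"] L(2)[OF l(1), of y] by simp
  qed
  obtain x0 where x0: "x0 \<in> frontier S" using ne by blast
  \<comment> \<open>Boundary values are limits of values in \<open>S\<close>, so the maximum of
    \<open>P\<close> is at least \<alpha>^2; this exceeds 2 F(u) and keeps critical points of u out
    of \<open>E\<close>.\<close>
  have "P x0 \<le> P m"
    by (rule continuous_le_on_closure[OF P_continuous _ PM]) (use x0 in \<open>auto simp: frontier_def\<close>)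
  then have M: "\<alpha>\<^sup>2 \<le> P m" using P_frontier(1)[OF x0] by simp
  define E where "E = {y \<in> S. P y = P m}"
  have "open E" unfolding E_def
  proof (rule P_max_set_open[OF PM])
    show "g y \<noteq> 0" if "y \<in> S" "P y = P m" for y
      using F_less[OF that(1)] that(2) M by (auto simp: P_def)
  qed
  moreover have "open (S - E)"
  proof -
    have "continuous_on S P" using P_continuous closure_subset continuous_on_subset by blast
    then have "open (S \<inter> P -` (- {P m}))" using open_S by (intro continuous_open_preimage) auto
    moreover have "S \<inter> P -` (- {P m}) = S - E" by (auto simp: E_def)
    ultimately show ?thesis by simp
  qed
  ultimately have "E = {} \<or> E = S" by (rule conn) (auto simp: E_def L(1) Pper)
  \<comment> \<open>If \<open>P\<close> were constant, the maximum point \<open>z\<close> of u,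
    interior since u is positive in \<open>S\<close>, would be critical with P z = 2 F(u z) <
    \<alpha>^2.\<close>
  moreover have "E \<noteq> S"
  proof
    assume ES: "E = S"
    have zS: "z \<in> S"
    proof (rule ccontr)
      assume "z \<notin> S"
      then have "u z = 0" using z open_S by (intro u_frontier) (auto simp: frontier_def interior_open)
      then show False using uM[OF x] pos[OF x] by simp
    qed
    have "(u has_derivative (\<lambda>k. gradient u z \<bullet> k)) (at z)"
      using has_derivative_gradient[of u z] C2 zS by (simp add: numeral_2_eq_2)
    from differential_zero_maxmin[OF zS open_S this] uM
    have "(\<lambda>k. gradient u z \<bullet> k) = (\<lambda>k. 0)" by blast
    then have "gradient u z \<bullet> gradient u z = 0" by meson
    then have "P z = 2 * F (u z)" using zS by (simp add: P_def g_eq)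
    then have "P z < P m" using F_less[OF zS] M by simp
    moreover have "z \<in> E" using zS ES by blast
    ultimately show False by (simp add: E_def)
  qed
  \<comment> \<open>The maximum is thus attained on the boundary only, where \<open>P\<close> is
    \<alpha>^2; emptiness of \<open>E\<close> gives strictness inside.\<close>
  ultimately have E0: "E = {}" by blast
  then have "m \<notin> S" by (auto simp: E_def)
  then have "P m = \<alpha>\<^sup>2" using m(1) open_S by (intro P_frontier) (auto simp: frontier_def interior_open)
  moreover have "P x \<noteq> P m" using E0 x by (auto simp: E_def)
  ultimately show ?thesis using PM[OF x] by simp
qed

lemma antiderivative_vanishing_at_0:
  fixes f :: "real \<Rightarrow> real"
  assumes f: "continuous_on UNIV f"
  shows "\<exists>F. (\<forall>t. (F has_real_derivative f t) (at t)) \<and> (\<forall>t\<ge>0. F t = integral {0..t} f)"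
proof -
  define F where "F t = integral {0..t} f - integral {t..0} f" for t
  have fi: "f integrable_on {a..b}" for a b
    by (rule integrable_continuous_real) (use f continuous_on_subset in blast)
  have F: "F t = integral {-b..t} f - integral {-b..0} f" if "-b \<le> t" "0 \<le> b" for t b
  proof (cases "0 \<le> t")
    case True
    then have "integral {t..0} f = 0" by (cases "t = 0") auto
    then show ?thesis
      using Henstock_Kurzweil_Integration.integral_combine[of "-b" 0 t f] True that fi by (simp add: F_def)
  next
    case False
    then show ?thesis
      using Henstock_Kurzweil_Integration.integral_combine[of "-b" t 0 f] that fi by (simp add: F_def)
  qed
  have "(F has_real_derivative f t) (at t)" for t
  proof -
    define b where "b = \<bar>t\<bar> + 1"
    have "((\<lambda>t. integral {-b..t} f) has_real_derivative f t) (at t within {-b..b})"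
      by (rule integral_has_real_derivative) (use f continuous_on_subset in \<open>auto simp: b_def\<close>)
    then have "((\<lambda>t. integral {-b..t} f) has_real_derivative f t) (at t)"
      using at_within_Icc_at[of "-b" t b] by (simp add: b_def)
    then have "((\<lambda>t. integral {-b..t} f - integral {-b..0} f) has_real_derivative f t - 0) (at t)"
      by (intro DERIV_diff DERIV_const)
    then have "((\<lambda>t. integral {-b..t} f - integral {-b..0} f) has_real_derivative f t) (at t)" by simp
    then show ?thesis
    proof (rule has_field_derivative_transform_within[of _ _ _ UNIV 1])
      fix s assume "dist s t < 1"
      then show "integral {-b..s} f - integral {-b..0} f = F s"
        by (intro F[symmetric]) (auto simp: b_def dist_real_def)
    qed auto
  qed
  moreover have "F t = integral {0..t} f" if "0 \<le> t" for t
    using F[of 0 t] that by simp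
  ultimately show ?thesis by blast
qed

lemma lattice_zero: "0 \<in> lattice v1 v2"
  unfolding lattice_def by (auto intro!: exI[of _ 0])

lemma lattice_add: "x \<in> lattice v1 v2 \<Longrightarrow> y \<in> lattice v1 v2 \<Longrightarrow> x + y \<in> lattice v1 v2"
  unfolding lattice_def mem_Collect_eq
  by (elim exE conjE, rule_tac x = "a + aa" in exI, rule_tac x = "b + ba" in exI) (simp add: algebra_simps)

lemma lattice_minus: "x \<in> lattice v1 v2 \<Longrightarrow> - x \<in> lattice v1 v2"
  unfolding lattice_def mem_Collect_eq
  by (elim exE conjE, rule_tac x = "- a" in exI, rule_tac x = "- b" in exI) simp

lemma torus_proj_eq_iff: "torus_proj (lattice v1 v2) x = torus_proj (lattice v1 v2) y \<longleftrightarrow> y - x \<in> lattice v1 v2"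
proof
  assume "torus_proj (lattice v1 v2) x = torus_proj (lattice v1 v2) y"
  moreover have "y \<in> torus_proj (lattice v1 v2) y"
    using lattice_zero by (force simp: torus_proj_def)
  ultimately have "y \<in> torus_proj (lattice v1 v2) x" by simp
  then show "y - x \<in> lattice v1 v2" by (auto simp: torus_proj_def)
next
  have *: "torus_proj (lattice v1 v2) y \<subseteq> torus_proj (lattice v1 v2) x" if "y - x \<in> lattice v1 v2" for x y
  proof
    fix z assume "z \<in> torus_proj (lattice v1 v2) y"
    then obtain l where "l \<in> lattice v1 v2" "z = x + ((y - x) + l)" by (auto simp: torus_proj_def)
    then show "z \<in> torus_proj (lattice v1 v2) x"
      using lattice_add[OF that, of l] unfolding torus_proj_def by blast
  qed
  assume a: "y - x \<in> lattice v1 v2"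
  moreover have "x - y \<in> lattice v1 v2" using lattice_minus[OF a] by simp
  ultimately show "torus_proj (lattice v1 v2) x = torus_proj (lattice v1 v2) y" using * by blast
qed

lemma torus_proj_add: "l \<in> lattice v1 v2 \<Longrightarrow> torus_proj (lattice v1 v2) (x + l) = torus_proj (lattice v1 v2) x"
  using torus_proj_eq_iff[of v1 v2 x "x + l"] by simp

lemma openin_torus_image:
  assumes "open A" shows "openin (torus (lattice v1 v2)) (torus_proj (lattice v1 v2) ` A)"
proof -
  have "torus_proj (lattice v1 v2) -` (torus_proj (lattice v1 v2) ` A) = (\<Union>l\<in>lattice v1 v2. (\<lambda>x. x + l) -` A)"
  proof (intro equalityI subsetI)
    fix x assume "x \<in> torus_proj (lattice v1 v2) -` (torus_proj (lattice v1 v2) ` A)"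
    then obtain a where "a \<in> A" "torus_proj (lattice v1 v2) x = torus_proj (lattice v1 v2) a" by auto
    then show "x \<in> (\<Union>l\<in>lattice v1 v2. (\<lambda>x. x + l) -` A)"
      unfolding torus_proj_eq_iff by (intro UN_I[of "a - x"]) auto
  next
    fix x assume "x \<in> (\<Union>l\<in>lattice v1 v2. (\<lambda>x. x + l) -` A)"
    then obtain l where "l \<in> lattice v1 v2" "x + l \<in> A" by auto
    then show "x \<in> torus_proj (lattice v1 v2) -` (torus_proj (lattice v1 v2) ` A)"
      using torus_proj_add[of l v1 v2 x] by (metis imageI vimageI)
  qed
  moreover have "open (\<Union>l\<in>lattice v1 v2. (\<lambda>x. x + l) -` A)"
    by (intro open_UN ballI open_vimage assms continuous_intros)
  ultimately show ?thesis unfolding openin_torus by auto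
qed

lemma vimage_closure_of_torus:
  "torus_proj (lattice v1 v2) -` (torus (lattice v1 v2) closure_of A) = closure (torus_proj (lattice v1 v2) -` A)"
proof (intro equalityI subsetI)
  let ?L = "lattice v1 v2"
  fix x assume x: "x \<in> torus_proj ?L -` (torus ?L closure_of A)"
  show "x \<in> closure (torus_proj ?L -` A)"
    unfolding closure_iff_nhds_not_empty
  proof (intro allI impI)
    fix U V assume V: "V \<subseteq> U" "open V" "x \<in> V"
    have "openin (torus ?L) (torus_proj ?L ` V)" by (rule openin_torus_image[OF V(2)])
    then obtain p where "p \<in> A" "p \<in> torus_proj ?L ` V" using x V(3) by (auto simp: in_closure_of)
    then show "torus_proj ?L -` A \<inter> U \<noteq> {}" using V by auto
  qed
next
  let ?L = "lattice v1 v2"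
  fix x assume x: "x \<in> closure (torus_proj ?L -` A)"
  have "\<exists>y. y \<in> A \<and> y \<in> T" if T: "torus_proj ?L x \<in> T" "openin (torus ?L) T" for T
  proof -
    have "open (torus_proj ?L -` T)" using T by (simp add: openin_torus)
    then have "torus_proj ?L -` A \<inter> torus_proj ?L -` T \<noteq> {}"
      using x T(1) unfolding closure_iff_nhds_not_empty by blast
    then show ?thesis by blast
  qed
  then show "x \<in> torus_proj ?L -` (torus ?L closure_of A)" by (auto simp: in_closure_of topspace_torus)
qed

lemma lattice_fundamental_domain:
  assumes "v1 \<noteq> v2" "independent {v1, v2}"
  shows "\<exists>l\<in>lattice v1 v2. x + l \<in> (\<lambda>(s, t). s *\<^sub>R v1 + t *\<^sub>R v2) ` ({0..1} \<times> {0..1})"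
proof -
  have "dim (span {v1, v2}) = dim (UNIV :: (real^2) set)"
    using assms by (simp add: dim_eq_card_independent)
  then have "span {v1, v2} = UNIV" by (metis dim_eq_full dim_span dim_UNIV DIM_cart)
  then have "x \<in> span {v1, v2}" by simp
  then obtain a b where "x = a *\<^sub>R v1 + b *\<^sub>R v2"
    by (auto simp: span_insert span_singleton) (metis add.commute diff_eq_eq)
  then have "x + (of_int (- \<lfloor>a\<rfloor>) *\<^sub>R v1 + of_int (- \<lfloor>b\<rfloor>) *\<^sub>R v2) = frac a *\<^sub>R v1 + frac b *\<^sub>R v2"
    by (simp add: frac_def algebra_simps)
  moreover have "frac a *\<^sub>R v1 + frac b *\<^sub>R v2 \<in> (\<lambda>(s, t). s *\<^sub>R v1 + t *\<^sub>R v2) ` ({0..1} \<times> {0..1})"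
    by (rule image_eqI[of _ _ "(frac a, frac b)"]) (auto simp: frac_lt_1 less_imp_le)
  moreover have "of_int (- \<lfloor>a\<rfloor>) *\<^sub>R v1 + of_int (- \<lfloor>b\<rfloor>) *\<^sub>R v2 \<in> lattice v1 v2"
    unfolding lattice_def by blast
  ultimately show ?thesis by (metis (no_types))
qed

lemma components_vimage_torus:
  assumes C: "C \<in> connected_components_of (subtopology (torus L) (topspace (torus L) - \<Omega>))"
    and K: "K \<in> components (torus_proj L -` C)"
  shows "K \<in> components (- (torus_proj L -` \<Omega>))"
proof -
  have Csub: "C \<subseteq> topspace (torus L) - \<Omega>"
    using connected_components_of_subset[OF C] by auto
  have K': "K \<noteq> {}" "K \<subseteq> torus_proj L -` C" "connected K"
    "\<And>D. D \<noteq> {} \<Longrightarrow> K \<subseteq> D \<Longrightarrow> D \<subseteq> torus_proj L -` C \<Longrightarrow> connected D \<Longrightarrow> K = D"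
    using K unfolding in_components_maximal by blast+
  have "K = D" if D: "D \<noteq> {}" "K \<subseteq> D" "D \<subseteq> - (torus_proj L -` \<Omega>)" "connected D" for D
  proof -
    have "connectedin euclidean D" using D by simp
    then have "connectedin (torus L) (torus_proj L ` D)"
      using connectedin_continuous_map_image[OF quotient_imp_continuous_map[OF quotient_map_torus_proj]] by blast
    then have "connectedin (subtopology (torus L) (topspace (torus L) - \<Omega>)) (torus_proj L ` D)"
      using D(3) by (auto simp: connectedin_subtopology topspace_torus)
    moreover have "\<not> disjnt C (torus_proj L ` D)" using K'(1,2) D(2) by (auto simp: disjnt_iff)
    ultimately have "torus_proj L ` D \<subseteq> C" using connected_components_of_maximal[OF C] by blast
    then show ?thesis using K'(4)[OF D(1,2) _ D(4)] by blast
  qed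
  then show ?thesis using K'(1-3) Csub unfolding in_components_maximal by blast
qed

lemma boundary_gradient_eq:
  assumes S: "open S" "x \<in> frontier S" and g: "continuous_on (closure S) g" "\<And>y. y \<in> S \<Longrightarrow> g y = gradient u y"
  shows "boundary_gradient S u x = g x"
proof -
  have x: "x \<in> closure S" "x \<notin> S" using S by (auto simp: frontier_def interior_open)
  have "(g \<longlongrightarrow> g x) (at x within closure S)" using g(1) x(1) by (simp add: continuous_on_def)
  then have "(g \<longlongrightarrow> g x) (at x within S)" by (rule tendsto_within_subset[OF _ closure_subset])
  then have "(gradient u \<longlongrightarrow> g x) (at x within S)"
    by (rule Lim_transform_eventually) (simp add: eventually_at_filter g(2))
  moreover have "at x within S \<noteq> bot" using x by (simp add: trivial_limit_within closure_def)
  ultimately show ?thesis unfolding boundary_gradient_def by (intro tendsto_Lim)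
qed

theorem theorem2p13:
  fixes v1 v2 :: "real^2" and L :: "(real^2) set"
    and \<Omega> :: "(real^2) set set" and u :: "(real^2) set \<Rightarrow> real"
    and f :: "real \<Rightarrow> real" and \<alpha> :: real
  defines "L \<equiv> lattice v1 v2"
  assumes "v1 \<noteq> v2" and "independent {v1, v2}"
    and "f C1_differentiable_on UNIV"
    and "\<alpha> \<le> 0"
    and "openin (torus L) \<Omega>" and "connectedin (torus L) \<Omega>" and "\<Omega> \<noteq> {}"
    and "C2_boundary (torus_proj L -` \<Omega>)"
    and "Ck_on_closure 2 (torus_proj L -` \<Omega>) (u \<circ> torus_proj L)"
    and "Ck_on 3 (torus_proj L -` \<Omega>) (u \<circ> torus_proj L)"
    and "\<forall>x \<in> torus_proj L -` \<Omega>.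
           laplacian (u \<circ> torus_proj L) x + f ((u \<circ> torus_proj L) x) = 0"
    and "\<forall>p \<in> \<Omega>. u p > 0"
    and "\<forall>p \<in> torus L frontier_of \<Omega>. u p = 0"
    and "\<forall>x \<in> torus_proj L -` (torus L frontier_of \<Omega>). \<forall>\<nu>.
           outward_unit_normal (torus_proj L -` \<Omega>) x \<nu> \<longrightarrow>
           boundary_gradient (torus_proj L -` \<Omega>) (u \<circ> torus_proj L) x \<bullet> \<nu> = \<alpha>"
    and "2 * (GREATEST m. m \<in> (\<lambda>p. integral {0..u p} f) ` (torus L closure_of \<Omega>)) < \<alpha>\<^sup>2"
  shows "\<forall>C \<in> connected_components_of (subtopology (torus L) (topspace (torus L) - \<Omega>)).
           torus_component_strictly_convex L C"
proof (intro ballI)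
  fix C assume C: "C \<in> connected_components_of (subtopology (torus L) (topspace (torus L) - \<Omega>))"
  let ?\<pi> = "torus_proj L"
  define S where "S = ?\<pi> -` \<Omega>"
  define U where "U = u \<circ> ?\<pi>"
  have S: "open S" and \<Omega>range: "\<Omega> \<subseteq> range ?\<pi>"
    using assms(6) by (auto simp: openin_torus S_def)
  have "S \<noteq> {}" using \<Omega>range assms(8) by (auto simp: S_def)
  have Sper: "x + l \<in> S" if "l \<in> L" "x \<in> S" for x l
    using that torus_proj_add[of l v1 v2 x] by (simp add: S_def L_def)
  have Uper: "U (x + l) = U x" if "l \<in> L" for x l
    using that torus_proj_add[of l v1 v2 x] by (simp add: U_def L_def)
  define Q where "Q = (\<lambda>(s, t). s *\<^sub>R v1 + t *\<^sub>R v2) ` ({0..1::real} \<times> {0..1::real})"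
  have Q: "compact Q" unfolding Q_def case_prod_unfold
    by (intro compact_continuous_image continuous_intros compact_Times compact_Icc)
  have Qcov: "\<exists>l\<in>L. x + l \<in> Q" for x
    using lattice_fundamental_domain[OF assms(2,3)] by (simp add: L_def Q_def)
  have cl: "?\<pi> -` (torus L closure_of \<Omega>) = closure S"
    unfolding L_def S_def by (rule vimage_closure_of_torus)
  have fr: "?\<pi> x \<in> torus L frontier_of \<Omega>" if "x \<in> frontier S" for x
  proof -
    have "?\<pi> x \<in> torus L closure_of \<Omega>" using that cl by (auto simp: frontier_def)
    moreover have "?\<pi> x \<notin> \<Omega>" using that S by (auto simp: frontier_def interior_open S_def)
    ultimately show ?thesis using assms(6) by (simp add: frontier_of_def interior_of_openin)
  qed
  have U0: "U x = 0" if "x \<in> frontier S" for x using fr[OF that] assms(14) by (simp add: U_def)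
  have Upos: "0 < U x" if "x \<in> S" for x using that assms(13) by (simp add: U_def S_def)
  have Ucl: "0 \<le> U x" if "x \<in> closure S" for x
    using that U0 Upos S by (cases "x \<in> S") (auto simp: frontier_def interior_open less_imp_le)
  have Ck: "continuous_on (closure S) U" "Ck_extends 2 S U"
    using assms(10) by (auto simp: Ck_on_closure_def S_def U_def)
  have ext: "extends_to_closure S (partial_deriv i U)" "extends_to_closure S (partial_deriv j (partial_deriv i U))" for i j
    using Ck(2) by (auto simp: numeral_2_eq_2)
  obtain G where G: "\<And>i. continuous_on (closure S) (G i)" "\<And>i x. x \<in> S \<Longrightarrow> G i x = partial_deriv i U x"
    using ext(1) unfolding extends_to_closure_def by metis
  obtain H where H: "\<And>i j. continuous_on (closure S) (H i j)"
      "\<And>i j x. x \<in> S \<Longrightarrow> H i j x = partial_deriv i (partial_deriv j U) x"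
    using ext(2) unfolding extends_to_closure_def by metis
  define g where "g x = G 1 x *\<^sub>R axis 1 1 + G 2 x *\<^sub>R (axis 2 1 :: real^2)" for x
  have gc: "continuous_on (closure S) g" unfolding g_def by (intro continuous_intros G)
  have ge: "g x = gradient U x" if "x \<in> S" for x
    using that by (simp add: g_def G gradient_def vec_eq_iff forall_2 axis_def)
  have fc: "continuous_on UNIV f" using assms(4) by (rule C1_differentiable_imp_continuous_on)
  obtain F where F: "\<And>t. (F has_real_derivative f t) (at t)" "\<And>t. 0 \<le> t \<Longrightarrow> F t = integral {0..t} f"
    using antiderivative_vanishing_at_0[OF fc] by blast
  have F0: "F 0 = 0" using F(2)[of 0] by simp
  have Fless: "2 * F (U x) < \<alpha>\<^sup>2" if x: "x \<in> closure S" for x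
  proof -
    let ?I = "(\<lambda>p. integral {0..u p} f) ` (torus L closure_of \<Omega>)"
    have I: "?I = (\<lambda>x. F (U x)) ` (closure S \<inter> Q)"
    proof (intro equalityI subsetI)
      fix m assume "m \<in> ?I"
      then obtain p where p: "p \<in> torus L closure_of \<Omega>" "m = integral {0..u p} f" by blast
      then obtain y where y: "p = ?\<pi> y" using closure_of_subset_topspace[of "torus L" \<Omega>] by (auto simp: topspace_torus)
      obtain l where l: "l \<in> L" "y + l \<in> Q" using Qcov by blast
      have p': "p = ?\<pi> (y + l)" using l y torus_proj_add[of l v1 v2 y] by (simp add: L_def)
      then have "y + l \<in> closure S" using p cl by auto
      moreover have "m = F (U (y + l))"
        using p p' F(2)[OF Ucl[OF \<open>y + l \<in> closure S\<close>]] by (simp add: U_def)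
      ultimately show "m \<in> (\<lambda>x. F (U x)) ` (closure S \<inter> Q)" using l by blast
    next
      fix m assume "m \<in> (\<lambda>x. F (U x)) ` (closure S \<inter> Q)"
      then obtain y where y: "y \<in> closure S" "m = F (U y)" by blast
      then have "?\<pi> y \<in> torus L closure_of \<Omega>" "m = integral {0..u (?\<pi> y)} f"
        using cl F(2)[OF Ucl[OF y(1)]] by (auto simp: U_def)
      then show "m \<in> ?I" by blast
    qed
    have xI: "F (U x) \<in> ?I"
      using x cl F(2)[OF Ucl[OF x]] by (intro image_eqI[of _ _ "?\<pi> x"]) (auto simp: U_def)
    have Fc: "continuous_on UNIV F" using F(1) by (meson DERIV_isCont continuous_at_imp_continuous_on)
    have "compact ?I" unfolding I
      by (intro compact_continuous_image continuous_on_compose2[OF Fc] continuous_on_subset[OF Ck(1)])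
        (auto simp: Q closed_Int_compact)
    then obtain M where "M \<in> ?I" "\<And>m. m \<in> ?I \<Longrightarrow> m \<le> M" using compact_attains_sup[of ?I] xI by blast
    then have "(GREATEST m. m \<in> ?I) = M" by (intro Greatest_equality) auto
    then show ?thesis using assms(16) \<open>\<And>m. m \<in> ?I \<Longrightarrow> m \<le> M\<close>[OF xI] by linarith
  qed
  show "torus_component_strictly_convex L C"
    unfolding torus_component_strictly_convex_def
  proof
    fix K assume "K \<in> components (?\<pi> -` C)"
    then have K: "K \<in> components (- S)" unfolding S_def by (rule components_vimage_torus[OF C])
    then have "- S \<noteq> {}" using in_components_nonempty in_components_subset by blast
    then have frne: "frontier S \<noteq> {}" using \<open>S \<noteq> {}\<close> by (auto simp: frontier_eq_empty)
    then obtain x0 where x0: "x0 \<in> frontier S" by blast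
    have "2 * F (U x0) < \<alpha>\<^sup>2" using Fless x0 by (auto simp: frontier_def)
    then have "\<alpha> < 0" using assms(5) U0[OF x0] F0 by (cases "\<alpha> = 0") auto
    interpret overdetermined_solution S U f F \<alpha> g "H 1 1" "H 1 2" "H 2 2"
    proof
      show "g x \<bullet> \<nu> = \<alpha>" if \<nu>: "outward_unit_normal S x \<nu>" for x \<nu>
      proof -
        have x: "x \<in> frontier S" using \<nu> by (simp add: outward_unit_normal_def)
        then have "boundary_gradient S U x \<bullet> \<nu> = \<alpha>" using fr assms(15) \<nu> by (simp add: S_def U_def)
        then show ?thesis using boundary_gradient_eq[OF S x gc ge] by simp
      qed
    qed (use S assms(9,11,12) F F0 Ck U0 gc ge H \<open>\<alpha> < 0\<close> in \<open>auto simp: S_def U_def\<close>)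
    have conn: "E = {} \<or> E = S"
      if E: "open E" "open (S - E)" "E \<subseteq> S" "\<And>x l. l \<in> L \<Longrightarrow> x \<in> E \<Longrightarrow> x + l \<in> E" for E
    proof -
      have o: "openin (torus L) (?\<pi> ` E)" "openin (torus L) (?\<pi> ` (S - E))"
        using openin_torus_image E(1,2) by (auto simp: L_def)
      have "\<Omega> \<subseteq> ?\<pi> ` E \<union> ?\<pi> ` (S - E)" using \<Omega>range by (auto simp: S_def)
      moreover have "?\<pi> ` E \<inter> ?\<pi> ` (S - E) \<inter> \<Omega> = {}"
      proof -
        have "False" if "a \<in> E" "b \<in> S - E" "?\<pi> a = ?\<pi> b" for a b
        proof -
          have "b - a \<in> L" using that(3) torus_proj_eq_iff[of v1 v2 a b] by (simp add: L_def)
          from E(4)[OF this that(1)] show False using that(2) by simp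
        qed
        then show ?thesis by blast
      qed
      ultimately have "?\<pi> ` E \<inter> \<Omega> = {} \<or> ?\<pi> ` (S - E) \<inter> \<Omega> = {}"
        using assms(7) o unfolding connectedin by blast
      then show ?thesis using E(3) by (auto simp: S_def)
    qed
    have "P x < \<alpha>\<^sup>2" if "x \<in> S" for x
    proof (rule P_less_boundary_value[where L = L and Q = Q])
      show "E = {} \<or> E = S" if "open E" "open (S - E)" "E \<subseteq> S"
          "\<And>x l. l \<in> L \<Longrightarrow> x \<in> E \<Longrightarrow> x + l \<in> E" for E
        using conn[OF that] .
      show "2 * F (U x) < \<alpha>\<^sup>2" if "x \<in> S" for x
        using Fless that closure_subset by blast
      show "\<exists>l\<in>L. x + l \<in> Q" for x by (rule Qcov)
    qed (fact Sper Uper Q Upos \<open>S \<noteq> {}\<close> frne that)+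
    then show "strictly_convex K" using K by (rule complement_component_strictly_convex)
  qed
qed

end
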